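(* For any $\alpha>1$, the density $f_{\mathcal{C}_\alpha}$ of the $\alpha$-Cauchy variable can be written, for $x\in\mathbb{R}$, as $$ f_{\mathcal{C}_\alpha}(x)=\frac{\sin(\pi/\alpha)}{2\pi/\alpha}\int_0^\infty e^{-x^2t}\,t^{\alpha/2-1}E_{\alpha/2,\alpha/2}(-t^{\alpha/2})\,dt . $$ Moreover, if $1<\alpha\le 2$, then the function $t\mapsto t^{\alpha/2-1}E_{\alpha/2,\alpha/2}(-t^{\alpha/2})$ is completely monotone on $(0,\infty)$.
   Context: For $\alpha>1$, the $\alpha$-Cauchy variable $\mathcal{C}_\alpha$ is a real random variable with density $f_{\mathcal{C}_\alpha}(x)=\frac{\sin(\pi/\alpha)}{2\pi/\alpha}\frac{1}{1+|x|^\alpha}$, $x\in\mathbb{R}$. For $\rho,\mu>0$, the two-parametric Mittag-Leffler function is the entire function $E_{\rho,\mu}(z)=\sum_{n\ge 0}\frac{z^n}{\Gamma(\mu+\rho n)}$, $z\in\mathbb{C}$. A non-negative function $f$ on $(0,\infty)$ is called completely monotone if it has derivatives of all orders and $(-1)^nf^{(n)}(x)\ge 0$ for all $n\ge 1$ and $x>0$.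
   Formalization: For α ≥ 4 the integral formula is stated only for real x with x² > cos(2π/α), since otherwise the integral diverges (e.g. α = 4, x = 0, where the integrand is sin t); for 1 < α < 4 it is stated for all real x. *)

theory Defs
  imports "HOL-Analysis.Analysis"
begin

definition cauchy_density :: "real \<Rightarrow> real \<Rightarrow> real" where
  "cauchy_density \<alpha> x = sin (pi / \<alpha>) / (2 * pi / \<alpha>) * (1 / (1 + \<bar>x\<bar> powr \<alpha>))"

text \<open>Polymorphic so that it covers both the entire function on the complex plane and its
  restriction to the real line; the coefficients are real.\<close>

definition mittag_leffler :: "real \<Rightarrow> real \<Rightarrow> 'a \<Rightarrow> 'a::{real_normed_field, banach}" where
  "mittag_leffler \<rho> \<mu> z = (\<Sum>n. z ^ n /\<^sub>R Gamma (\<mu> + \<rho> * real n))"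

definition completely_monotone :: "(real \<Rightarrow> real) \<Rightarrow> bool" where
  "completely_monotone f \<longleftrightarrow>
     (\<forall>x>0. 0 \<le> f x) \<and>
     (\<forall>n. \<forall>x>0. (deriv ^^ n) f differentiable (at x)) \<and>
     (\<forall>n\<ge>1. \<forall>x>0. 0 \<le> (-1) ^ n * (deriv ^^ n) f x)"

text \<open>The Laplace integral of \<open>t powr (\<alpha>/2 - 1) * E(- t powr (\<alpha>/2))\<close> diverges for some real
  arguments \<open>x\<^sup>2\<close> once \<open>\<alpha> \<ge> 4\<close>; the abscissa of convergence is then \<open>cos (2*pi/\<alpha>)\<close>, the real part of the
  rightmost singularities \<open>exp (\<plusminus> 2*pi*\<i>/\<alpha>)\<close> of \<open>1 / (1 + s powr (\<alpha>/2))\<close>. The simplest instance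
  is \<open>\<alpha> = 4\<close>, \<open>x = 0\<close>, where the integrand is the sine function.\<close>

lemma mittag_leffler_2_2:
  fixes t :: real
  assumes "t > 0"
  shows "t * mittag_leffler 2 2 (- (t\<^sup>2)) = sin t"
proof -
  have eq: "(\<lambda>n. t * ((- (t\<^sup>2)) ^ n /\<^sub>R Gamma (2 + 2 * real n)))
      = (\<lambda>n. (- 1) ^ n / fact (2 * n + 1) * t ^ (2 * n + 1))"
  proof
    fix n
    have "Gamma (2 + 2 * real n) = Gamma (1 + real (2 * n + 1))"
      by (simp add: algebra_simps)
    also have "\<dots> = fact (2 * n + 1)"
      by (rule Gamma_fact)
    finally have "Gamma (2 + 2 * real n) = fact (2 * n + 1)" .
    moreover have "(- (t\<^sup>2)) ^ n = (- 1) ^ n * t ^ (2 * n)"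
      by (metis power_minus power_mult)
    ultimately show "t * ((- (t\<^sup>2)) ^ n /\<^sub>R Gamma (2 + 2 * real n))
        = (- 1) ^ n / fact (2 * n + 1) * t ^ (2 * n + 1)"
      by (simp add: field_simps)
  qed
  have "(\<lambda>n. (- 1) ^ n / fact (2 * n + 1) * t ^ (2 * n + 1)) sums sin t"
    using sin_paired[of t] by simp
  then have sm: "(\<lambda>n. t * ((- (t\<^sup>2)) ^ n /\<^sub>R Gamma (2 + 2 * real n))) sums sin t"
    by (simp only: eq)
  then have "summable (\<lambda>n. (- (t\<^sup>2)) ^ n /\<^sub>R Gamma (2 + 2 * real n))"
    using assms by (auto dest!: sums_summable simp only: summable_cmult_iff)
  then show ?thesis
    using sm unfolding mittag_leffler_def
    by (simp only: suminf_mult[symmetric] sums_iff)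
qed

lemma laplace_representation_fails_at_4:
  defines "g \<equiv> \<lambda>t::real. exp (- (0\<^sup>2) * t) * (t powr (4/2 - 1) * mittag_leffler (4/2) (4/2) (- (t powr (4/2))))"
  shows "\<not> set_integrable lborel {0<..} g"
    and "cauchy_density 4 0 \<noteq> sin (pi/4) / (2*pi/4) * (LBINT t:{0<..}. g t)"
proof -
  have g: "g t = sin t" if "t > 0" for t
    using mittag_leffler_2_2[OF that] that by (simp add: g_def powr_numeral)
  show ni: "\<not> set_integrable lborel {0<..} g"
  proof
    assume "set_integrable lborel {0<..} g"
    then have "set_integrable lborel {0<..} (sin :: real \<Rightarrow> real)"
      using set_integrable_cong[of lborel lborel "{0<..}" "{0<..}" g sin] g by auto
    then have int: "set_integrable lborel {1..} (sin :: real \<Rightarrow> real)"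
      by (rule set_integrable_subset) auto
    define L where "L = (LBINT t:{1..}. sin (t::real))"
    have conv: "((\<lambda>b::real. LBINT t:{1..b}. sin t) \<longlongrightarrow> L) at_top"
      unfolding L_def by (rule tendsto_set_lebesgue_integral_at_top) (use int in auto)
    have ftc: "(LBINT t:{1..b}. sin t) = cos 1 - cos b" if "b \<ge> 1" for b :: real
      using that unfolding set_lebesgue_integral_def
      by (subst integral_FTC_atLeastAtMost[where F = "\<lambda>t. - cos t"])
         (auto intro!: derivative_eq_intros continuous_intros
               simp flip: has_real_derivative_iff_has_vector_derivative)
    have ev: "\<forall>\<^sub>F b::real in at_top. (LBINT t:{1..b}. sin t) = cos 1 - cos b"
      by (intro eventually_mono[OF eventually_ge_at_top[of 1]] ftc)
    have lim: "((\<lambda>b::real. cos 1 - cos b) \<longlongrightarrow> L) at_top"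
      using conv by (simp only: tendsto_cong[OF ev])
    have seq: "filterlim (\<lambda>n. c + real n * (2 * pi)) at_top sequentially" for c
      by (intro filterlim_tendsto_add_at_top[OF tendsto_const]
            filterlim_at_top_mult_tendsto_pos[OF tendsto_const] filterlim_real_sequentially) simp
    have *: "cos 1 - cos c = L" for c :: real
    proof (rule LIMSEQ_unique)
      show "(\<lambda>n. cos 1 - cos (c + real n * (2 * pi))) \<longlonglongrightarrow> L"
        by (rule filterlim_compose[OF lim seq])
      have "cos (c + real n * (2 * pi)) = cos c" for n
        using cos.plus_of_nat[of c n] by simp
      then show "(\<lambda>n. cos 1 - cos (c + real n * (2 * pi))) \<longlonglongrightarrow> cos 1 - cos c"
        by simp
    qed
    show False
      using *[of 0] *[of pi] by simp
  qed
  show "cauchy_density 4 0 \<noteq> sin (pi/4) / (2*pi/4) * (LBINT t:{0<..}. g t)"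
  proof -
    have "(LBINT t:{0<..}. g t) = 0"
      using ni unfolding set_integrable_def set_lebesgue_integral_def
      by (rule not_integrable_integral_eq)
    moreover have "cauchy_density 4 0 > 0"
      by (simp add: cauchy_density_def sin_45)
    ultimately show ?thesis by (simp only: mult_zero_right)
  qed
qed

end

(*
Put a = \<alpha>/2 and f t = t powr (a - 1) * E_{a,a}(- t powr a). Integrating the series of f termwise gives
its Laplace transform F s = 1 / (1 + s powr a) for s > 1 only; smaller s are out of reach of the
series. Instead f is identified, by uniqueness of Laplace transforms, with an integral of
exponentials whose Laplace transform is F on a larger half line by Cauchy's formula on a half plane.
For a > 1 the exponents run over a vertical line Re z = \<sigma> with \<sigma> > max 0 (cos (pi / a)), which has all
zeros of 1 + z powr a on its left. For 1/2 < a < 1 they run over the negative half line; there the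
weight is nonnegative, and this is complete monotonicity. The value at s = 0 needs f to be
integrable: for a \<le> 1 this follows from f \<ge> 0 by monotone convergence, and for 1 < a < 2 from
f t = O(1 / t^2), obtained from the second derivative of F on the line Re z = 1 / t.
*)

theory Submission
  imports Defs "HOL-Complex_Analysis.Complex_Analysis"
begin

section \<open>Laplace transforms and their uniqueness\<close>

text \<open>The terms of the series for \<open>f\<close> grow and cancel, so absolute estimates stop
  at s = 1 although the transform exists further left. Uniqueness gets around this without deforming
  contours: only real s occur, and each representation is one application of Cauchy's formula with
  the pole s. The case split in a comes from absolute integrability. On vertical lines F decays like
  |z|^(-a), which is integrable for a > 1. In the coordinate w = sqrt z it decays like |w|^(-2a), so
  a > 1/2 suffices there, while 1 + w^(2a) has no zero in the closed right half plane exactly if a <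
  1. The value a = 1 fits neither case, but then f is exp(-t). On the line Re z = 1/t, F itself
  yields only f = O(1) and its first derivative only O(1/t), which is not integrable. The second
  derivative is the first to give enough decay; its singularity |z|^(a-2) at 0 is still integrable
  because a > 1.\<close>

lemma nonneg_has_integral_imp_LBINT:
  fixes f :: "real \<Rightarrow> real"
  assumes I: "(f has_integral I) S" and S: "S \<in> sets borel"
    and [measurable]: "set_borel_measurable borel S f" and nn: "\<And>x. x \<in> S \<Longrightarrow> 0 \<le> f x"
  shows "set_integrable lborel S f" "(LBINT x:S. f x) = I"
proof -
  have "f absolutely_integrable_on S"
    using I nn by (intro nonnegative_absolutely_integrable_1) auto
  then show int: "set_integrable lborel S f"
    using assms(3) unfolding set_integrable_def set_borel_measurable_def
    by (subst (asm) integrable_completion) auto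
  show "(LBINT x:S. f x) = I"
    using set_borel_integral_eq_integral(2)[OF int] integral_unique[OF I] by simp
qed

lemma laplace_exp_real:
  fixes a :: real
  assumes "a > 0"
  shows "set_integrable lborel {0<..} (\<lambda>t. exp (- a * t))" "(LBINT t:{0<..}. exp (- a * t)) = 1 / a"
proof -
  have "((\<lambda>t. exp (- a * t)) has_integral 1 / a) {0..}"
    using has_integral_exp_minus_to_infinity[OF assms, of 0] by simp
  then have *: "((\<lambda>t. exp (- a * t)) has_integral 1 / a) {0<..}"
    by (rule has_integral_spike_set_eq[THEN iffD1, rotated 2])
       (auto intro!: negligible_subset[OF negligible_sing[of 0]])
  have m: "set_borel_measurable borel {0<..} (\<lambda>t. exp (- a * t))"
    unfolding set_borel_measurable_def by measurable
  show "set_integrable lborel {0<..} (\<lambda>t. exp (- a * t))" "(LBINT t:{0<..}. exp (- a * t)) = 1 / a"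
    using nonneg_has_integral_imp_LBINT[OF * _ m] by auto
qed

lemma laplace_exp_complex:
  fixes c :: complex
  assumes "Re c > 0"
  shows "set_integrable lborel {0<..} (\<lambda>t. exp (- c * complex_of_real t))"
    and "(LBINT t:{0<..}. exp (- c * complex_of_real t)) = 1 / c"
proof -
  show int: "set_integrable lborel {0<..} (\<lambda>t. exp (- c * complex_of_real t))"
    unfolding set_integrable_def
    by (rule Bochner_Integration.integrable_bound
          [OF laplace_exp_real(1)[OF assms, unfolded set_integrable_def]])
       (auto simp: indicator_def)
  have [simp]: "c \<noteq> 0" using assms by auto
  let ?F = "\<lambda>t. - exp (- c * complex_of_real t) / c"
  have e: "einterval 0 \<infinity> = {0::real<..}"
    by (auto simp: einterval_def zero_ereal_def)
  have "(LBINT t=0..\<infinity>. exp (- c * complex_of_real t)) = 0 - (- 1 / c)"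
  proof (rule interval_integral_FTC_integrable[where F = ?F])
    show "(?F has_vector_derivative exp (- c * complex_of_real x)) (at x)" for x
      by (auto intro!: derivative_eq_intros has_vector_derivative_real_field)
    show "((?F \<circ> real_of_ereal) \<longlongrightarrow> - 1 / c) (at_right 0)"
    proof -
      have "(?F \<longlongrightarrow> ?F 0) (at_right 0)"
        by (intro tendsto_intros) auto
      then show ?thesis by (simp add: zero_ereal_def ereal_tendsto_simps)
    qed
    show "((?F \<circ> real_of_ereal) \<longlongrightarrow> 0) (at_left \<infinity>)"
    proof -
      have "filterlim (\<lambda>t::real. Re c * t) at_top at_top"
        by (rule filterlim_tendsto_pos_mult_at_top[OF tendsto_const assms filterlim_ident])
      then have "((\<lambda>t::real. exp (- (Re c * t))) \<longlongrightarrow> 0) at_top"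
        by (intro filterlim_compose[OF exp_at_bot])
           (simp add: filterlim_uminus_at_top)
      then have "((\<lambda>t::real. exp (- (Re c * t)) / norm c) \<longlongrightarrow> 0 / norm c) at_top"
        by (intro tendsto_divide) auto
      then have "(?F \<longlongrightarrow> 0) at_top"
        by (subst tendsto_norm_zero_iff[symmetric]) (simp add: norm_divide)
      then show ?thesis by (simp add: ereal_tendsto_simps)
    qed
  qed (use int e in \<open>auto intro!: continuous_intros\<close>)
  then show "(LBINT t:{0<..}. exp (- c * complex_of_real t)) = 1 / c"
    by (simp add: interval_lebesgue_integral_def e)
qed

text \<open>Testing against \<open>exp (- t)\<close>-polynomials determines the integral against every continuous
  function of \<open>exp (- t)\<close>, by Weierstrass; a bump function then detects a point where \<open>h\<close> is
  nonzero.\<close>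

lemma laplace_eq_zero_imp_nonpos:
  fixes h :: "real \<Rightarrow> real"
  assumes cont: "continuous_on {0<..} h"
    and int: "\<And>s. s > s1 \<Longrightarrow> set_integrable lborel {0<..} (\<lambda>t. exp (- s * t) * h t)"
    and zero: "\<And>s. s > s1 \<Longrightarrow> (LBINT t:{0<..}. exp (- s * t) * h t) = 0"
    and t0: "t0 > 0"
  shows "h t0 \<le> 0"
proof (rule ccontr)
  assume "\<not> h t0 \<le> 0"
  then have pos: "h t0 > 0" by simp
  \<comment> \<open>The base exponent \<open>s1 + 1\<close> is admissible, so
    \<open>exp (- t) ^ n * H t\<close> is the given integrand at \<open>s1 + 1 + n\<close>: all
    moments of \<open>H\<close> in the variable \<open>exp (- t)\<close> vanish.\<close>
  define H where "H t = indicator {0<..} t *\<^sub>R (exp (- (s1 + 1) * t) * h t)" for t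
  have intH: "integrable lborel H"
    using int[of "s1 + 1"] by (simp add: set_integrable_def H_def[abs_def])
  have Hn: "exp (- t) ^ n * H t = indicator {0<..} t *\<^sub>R (exp (- (s1 + 1 + real n) * t) * h t)" for n t
    by (simp add: H_def exp_of_nat_mult[symmetric] exp_add[symmetric] algebra_simps indicator_def)
  have mono: "integrable lborel (\<lambda>t. exp (- t) ^ n * H t) \<and> (LBINT t. exp (- t) ^ n * H t) = 0" for n
  proof -
    have "s1 + 1 + real n > s1" by simp
    from int[OF this] zero[OF this] show ?thesis
      unfolding Hn set_integrable_def set_lebesgue_integral_def by (rule conjI)
  qed
  have poly: "(LBINT t. q (exp (- t)) * H t) = 0 \<and> integrable lborel (\<lambda>t. q (exp (- t)) * H t)"
    if "real_polynomial_function q" for q :: "real \<Rightarrow> real"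
  proof -
    from real_polynomial_function_imp_sum[OF that]
    obtain c n where q: "q = (\<lambda>x. \<Sum>i\<le>n. c i * x ^ i)"
      by (elim exE) (rule that)
    have q_mult: "q (exp (- t)) * H t = (\<Sum>i\<le>n. c i * (exp (- t) ^ i * H t))" for t
      by (simp only: q sum_distrib_right mult.assoc)
    have "integrable lborel (\<lambda>t. c i * (exp (- t) ^ i * H t))"
      and "(LBINT t. c i * (exp (- t) ^ i * H t)) = 0" for i
      using mono[of i] by (simp_all only: integrable_mult_right integral_mult_right_zero mult_zero_right)
    then show ?thesis
      unfolding q_mult by (auto simp: Bochner_Integration.integral_sum intro!: sum.neutral)
  qed
  have cts: "(LBINT t. \<phi> (exp (- t)) * H t) = 0" if \<phi>: "continuous_on UNIV \<phi>" for \<phi> :: "real \<Rightarrow> real"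
  proof -
    define N where "N = (LBINT t. \<bar>H t\<bar>)"
    have [measurable]: "\<phi> \<in> borel_measurable borel" "H \<in> borel_measurable borel"
      using \<phi> intH by (auto intro: borel_measurable_continuous_onI)
    have "\<bar>LBINT t. \<phi> (exp (- t)) * H t\<bar> \<le> e * N" if "e > 0" for e
    proof -
      obtain q where q: "real_polynomial_function q" "\<And>x. x \<in> {0..1} \<Longrightarrow> \<bar>\<phi> x - q x\<bar> < e"
        using Stone_Weierstrass_real_polynomial_function[of "{0..1}" \<phi> e] \<phi> \<open>e > 0\<close>
        by (metis compact_Icc continuous_on_subset subset_UNIV)
      have [measurable]: "q \<in> borel_measurable borel"
        using q(1) by (intro borel_measurable_continuous_onI continuous_on_polymonial_function)
          (simp add: real_polynomial_function_eq)
      \<comment> \<open>Approximation on [0, 1] is enough: \<open>exp (- t)\<close> lies there for t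
        > 0, and \<open>H\<close> vanishes for t \<le> 0.\<close>
      have bd: "\<bar>(\<phi> (exp (- t)) - q (exp (- t))) * H t\<bar> \<le> e * \<bar>H t\<bar>" for t
        using q(2)[of "exp (- t)"] by (cases "t > 0") (auto simp: H_def abs_mult intro!: mult_right_mono)
      have i1: "integrable lborel (\<lambda>t. (\<phi> (exp (- t)) - q (exp (- t))) * H t)"
        by (rule Bochner_Integration.integrable_bound[where f = "\<lambda>t. e * \<bar>H t\<bar>"])
           (use intH bd \<open>e > 0\<close> in auto)
      have "(LBINT t. \<phi> (exp (- t)) * H t)
          = (LBINT t. (\<phi> (exp (- t)) - q (exp (- t))) * H t + q (exp (- t)) * H t)"
        by (simp add: algebra_simps)
      also have "\<dots> = (LBINT t. (\<phi> (exp (- t)) - q (exp (- t))) * H t)"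
        using poly[OF q(1)] i1 by (subst Bochner_Integration.integral_add) auto
      also have "\<bar>\<dots>\<bar> \<le> (LBINT t. \<bar>(\<phi> (exp (- t)) - q (exp (- t))) * H t\<bar>)"
        by (rule integral_abs_bound)
      also have "\<dots> \<le> (LBINT t. e * \<bar>H t\<bar>)"
        by (rule integral_mono) (use i1 intH bd in auto)
      finally show ?thesis by (simp add: N_def)
    qed
    moreover have N: "N \<ge> 0" by (simp add: N_def)
    \<comment> \<open>\<open>N\<close> could be 0, hence the division by
      \<open>N + 1\<close>.\<close>
    moreover have "e / (N + 1) * N \<le> e" if "e > 0" for e
      using that N by (simp add: field_simps)
    ultimately have "\<bar>LBINT t. \<phi> (exp (- t)) * H t\<bar> \<le> 0 + e" if "e > 0" for e
      using that by (metis add_0 add_nonneg_pos divide_pos_pos order_trans zero_less_one)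
    then show ?thesis using field_le_epsilon[of "\<bar>LBINT t. \<phi> (exp (- t)) * H t\<bar>" 0] by auto
  qed
  obtain d where d: "d > 0" "d < t0" "\<And>t. t \<in> {t0 - d<..<t0 + d} \<Longrightarrow> h t > 0"
  proof -
    have "isCont h t0"
      using cont t0 by (simp add: continuous_on_eq_continuous_at)
    then obtain e where e: "e > 0" "\<And>t. dist t t0 < e \<Longrightarrow> dist (h t) (h t0) < h t0"
      using pos by (metis continuous_at_eps_delta)
    have "h t > 0" if "t \<in> {t0 - min e (t0 / 2)<..<t0 + min e (t0 / 2)}" for t
    proof -
      have "dist t t0 < e" using that by (auto simp: dist_real_def abs_less_iff)
      from e(2)[OF this] show ?thesis by (auto simp: dist_real_def abs_less_iff)
    qed
    then show thesis
      using e(1) t0 by (intro that[of "min e (t0 / 2)"]) auto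
  qed
  \<comment> \<open>Since \<open>exp (- t)\<close> decreases, \<open>u1\<close> and
    \<open>u2\<close> are the images of the right and the left end of the interval around
    \<open>t0\<close>. The truncated parabola below is positive exactly between them.\<close>
  define u1 u2 where "u1 = exp (- (t0 + d))" and "u2 = exp (- (t0 - d))"
  define \<phi> where "\<phi> u = max 0 ((u - u1) * (u2 - u))" for u
  have \<phi>pos: "\<phi> (exp (- t)) > 0" if "t \<in> {t0 - d<..<t0 + d}" for t
    using that by (auto simp: \<phi>_def u1_def u2_def less_max_iff_disj)
  have \<phi>zero: "\<phi> (exp (- t)) = 0" if "t \<notin> {t0 - d<..<t0 + d}" for t
  proof -
    have "(exp (- t) \<le> u1 \<and> exp (- t) \<le> u2) \<or> (exp (- t) \<ge> u1 \<and> exp (- t) \<ge> u2)"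
      using that d(1) by (auto simp: u1_def u2_def)
    then show ?thesis by (auto simp: \<phi>_def max_def mult_le_0_iff antisym zero_le_mult_iff)
  qed
  have "(LBINT t. \<phi> (exp (- t)) * H t) = 0"
    by (rule cts) (auto simp: \<phi>_def intro!: continuous_intros)
  moreover have nn: "\<phi> (exp (- t)) * H t \<ge> 0" for t
    using \<phi>zero[of t] \<phi>pos[of t] d(3)[of t]
    by (cases "t \<in> {t0 - d<..<t0 + d}") (auto simp: H_def indicator_def)
  moreover have "integrable lborel (\<lambda>t. \<phi> (exp (- t)) * H t)"
  proof -
    have [measurable]: "H \<in> borel_measurable borel" using intH by auto
    have [measurable]: "\<phi> \<in> borel_measurable borel" unfolding \<phi>_def by measurable
    have "\<bar>\<phi> u\<bar> \<le> (1 + u1) * (u2 + 1)" if "0 \<le> u" "u \<le> 1" for u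
    proof -
      have "\<bar>(u - u1) * (u2 - u)\<bar> \<le> (1 + u1) * (u2 + 1)"
        unfolding abs_mult by (rule mult_mono) (use that in \<open>auto simp: u1_def u2_def abs_le_iff add_increasing add_increasing2\<close>)
      then show ?thesis by (auto simp: \<phi>_def)
    qed
    then have bd: "\<bar>\<phi> (exp (- t))\<bar> \<le> (1 + u1) * (u2 + 1)" if "t > 0" for t
      using that by simp
    have "norm (\<phi> (exp (- t)) * H t) \<le> norm ((1 + u1) * (u2 + 1) * H t)" for t
    proof (cases "t > 0")
      case True
      then show ?thesis
        unfolding norm_mult[of _ "H t"]
        by (intro mult_right_mono) (auto intro: order.trans[OF bd abs_ge_self])
    qed (simp add: H_def)
    then show ?thesis
      by (intro Bochner_Integration.integrable_bound[where g = "\<lambda>t. \<phi> (exp (- t)) * H t" and f = "\<lambda>t. (1 + u1) * (u2 + 1) * H t"])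
         (use intH in auto)
  qed
  ultimately have ae: "AE t in lborel. \<phi> (exp (- t)) * H t = 0"
    by (subst (asm) integral_nonneg_eq_0_iff_AE) auto
  have posH: "\<phi> (exp (- t)) * H t > 0" if "t \<in> {t0 - d<..<t0 + d}" for t
    using that d \<phi>pos[OF that] by (auto simp: H_def)
  have "AE t in lborel. t \<notin> {t0 - d<..<t0 + d}"
    using ae by (rule eventually_mono) (metis posH less_irrefl)
  then have "{t0 - d<..<t0 + d} \<in> null_sets lborel"
    by (subst AE_iff_null_sets) auto
  then show False using d(1) by (simp add: null_sets_def)
qed

text \<open>The one-sided result applies to \<open>f - g\<close> and to \<open>g - f\<close>;
  continuity is what gives equality at every point.\<close>

lemma laplace_inj:
  fixes f g :: "real \<Rightarrow> real"
  assumes cf: "continuous_on {0<..} f" and cg: "continuous_on {0<..} g"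
    and f: "\<And>s. s > s1 \<Longrightarrow> set_integrable lborel {0<..} (\<lambda>t. exp (- s * t) * f t)"
    and g: "\<And>s. s > s1 \<Longrightarrow> set_integrable lborel {0<..} (\<lambda>t. exp (- s * t) * g t)"
    and eq: "\<And>s. s > s1 \<Longrightarrow> (LBINT t:{0<..}. exp (- s * t) * f t) = (LBINT t:{0<..}. exp (- s * t) * g t)"
    and t: "t > 0"
  shows "f t = g t"
proof (rule antisym)
  have "f t - g t \<le> 0"
    by (rule laplace_eq_zero_imp_nonpos[of "\<lambda>t. f t - g t" s1 t, OF continuous_on_diff[OF cf cg] _ _ t])
       (simp_all only: right_diff_distrib set_integral_diff f g eq diff_self)
  then show "f t \<le> g t" by simp
  have "g t - f t \<le> 0"
    by (rule laplace_eq_zero_imp_nonpos[of "\<lambda>t. g t - f t" s1 t, OF continuous_on_diff[OF cg cf] _ _ t])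
       (simp_all only: right_diff_distrib set_integral_diff f g eq diff_self)
  then show "g t \<le> f t" by simp
qed

section \<open>Integrals of exponentials over a parameter\<close>

text \<open>Fubini: the transform of exp(p y t) at s is 1 / (s - p y), and \<open>int\<close> is the
  integrability of the joint integrand's norm once t is integrated out. Later \<open>p\<close> runs
  along a vertical line or along the negative half line.\<close>

lemma exp_mixture_laplace:
  fixes p k :: "real \<Rightarrow> complex" and s :: real
  assumes [measurable]: "p \<in> borel_measurable borel" "k \<in> borel_measurable borel"
    and ps: "\<And>y. Re (p y) < s"
    and int: "integrable lborel (\<lambda>y. norm (k y) / (s - Re (p y)))"
  defines "g \<equiv> \<lambda>t. LBINT y. exp (p y * complex_of_real t) * k y"
  shows "set_integrable lborel {0<..} (\<lambda>t. exp (- s * t) * Re (g t))"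
    and "(LBINT t:{0<..}. exp (- s * t) * Re (g t)) = Re (LBINT y. k y / (s - p y))"
proof -
  define \<Phi> where "\<Phi> y t = (indicator {0<..} t *\<^sub>R exp (- (s - p y) * complex_of_real t)) * k y" for y t
  have pos: "Re (s - p y) > 0" for y using ps[of y] by simp
  have m[measurable]: "(\<lambda>(y, t). \<Phi> y t) \<in> borel_measurable (lborel \<Otimes>\<^sub>M lborel)"
    unfolding \<Phi>_def by measurable
  have i1: "integrable lborel (\<Phi> y)" "(LBINT t. \<Phi> y t) = k y / (s - p y)" for y
  proof -
    note L = laplace_exp_complex[OF pos[of y], unfolded set_integrable_def set_lebesgue_integral_def]
    show "integrable lborel (\<Phi> y)"
      unfolding \<Phi>_def by (rule integrable_mult_left) (rule L(1))
    have "(LBINT t. \<Phi> y t) = (LBINT t. indicator {0<..} t *\<^sub>R exp (- (s - p y) * complex_of_real t)) * k y"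
      unfolding \<Phi>_def by (rule integral_mult_left_zero)
    then show "(LBINT t. \<Phi> y t) = k y / (s - p y)"
      unfolding L(2) by simp
  qed
  have nrm: "norm (\<Phi> y t) = indicator {0<..} t *\<^sub>R exp (- Re (s - p y) * t) * norm (k y)" for y t
    by (simp add: \<Phi>_def norm_mult)
  have i2: "(LBINT t. norm (\<Phi> y t)) = norm (k y) / (s - Re (p y))" for y
    using laplace_exp_real[OF pos[of y]]
    unfolding nrm set_integrable_def set_lebesgue_integral_def by simp
  have i3: "integrable (lborel \<Otimes>\<^sub>M lborel) (\<lambda>(y, t). \<Phi> y t)"
    by (rule lborel_pair.Fubini_integrable) (use int i1 i2 in auto)
  have g: "(LBINT y. \<Phi> y t) = indicator {0<..} t *\<^sub>R (exp (- s * t) *\<^sub>R g t)" for t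
  proof -
    have "\<Phi> y t = (indicator {0<..} t * exp (- s * t)) *\<^sub>R (exp (p y * complex_of_real t) * k y)" for y
      by (simp add: \<Phi>_def indicator_def scaleR_conv_of_real exp_of_real[symmetric] exp_add[symmetric] algebra_simps mult_exp_exp)
    then show ?thesis by (simp add: g_def)
  qed
  have I: "integrable lborel (\<lambda>t. indicator {0<..} t *\<^sub>R (exp (- s * t) *\<^sub>R g t))"
    using lborel_pair.integrable_snd[OF i3] by (simp add: g)
  have J: "(LBINT t. indicator {0<..} t *\<^sub>R (exp (- s * t) *\<^sub>R g t)) = (LBINT y. k y / (s - p y))"
    using lborel_pair.Fubini_integral[OF i3] by (simp add: g i1)
  have R: "Re (indicator {0<..} t *\<^sub>R (exp (- s * t) *\<^sub>R g t)) = indicator {0<..} t *\<^sub>R (exp (- s * t) * Re (g t))" for t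
    by simp
  show "set_integrable lborel {0<..} (\<lambda>t. exp (- s * t) * Re (g t))"
    unfolding set_integrable_def using integrable_Re[OF I] by (simp only: R)
  show "(LBINT t:{0<..}. exp (- s * t) * Re (g t)) = Re (LBINT y. k y / (s - p y))"
    unfolding set_lebesgue_integral_def J[symmetric] integral_Re[OF I, symmetric] by (simp only: R)
qed

text \<open>Dominated convergence: for x between t/2 and 2t the value exp(Re (p y) x) is at most the
  sum of its values at the two ends, whatever the sign of \<open>Re (p y)\<close>.\<close>

lemma continuous_on_exp_mixture:
  fixes p k :: "real \<Rightarrow> complex"
  assumes [measurable]: "p \<in> borel_measurable borel" "k \<in> borel_measurable borel"
    and int: "\<And>t. t > 0 \<Longrightarrow> integrable lborel (\<lambda>y. exp (Re (p y) * t) * norm (k y))"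
  shows "continuous_on {0<..} (\<lambda>t. LBINT y. exp (p y * complex_of_real t) * k y)"
proof (rule continuous_at_imp_continuous_on, rule ballI)
  fix t :: real assume "t \<in> {0<..}"
  then have t: "t > 0" by simp
  show "isCont (\<lambda>t. LBINT y. exp (p y * complex_of_real t) * k y) t"
    unfolding continuous_at_sequentially o_def
  proof safe
    fix x :: "nat \<Rightarrow> real" assume x: "x \<longlonglongrightarrow> t"
    then have "\<forall>\<^sub>F n in sequentially. x n \<in> {t / 2<..<2 * t}"
      using t by (intro topological_tendstoD) auto
    then obtain N where N: "\<And>n. n \<ge> N \<Longrightarrow> x n \<in> {t / 2<..<2 * t}"
      by (auto simp: eventually_sequentially)
    \<comment> \<open>The majorant is valid only once \<open>x n\<close> lies in (t/2, 2t); the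
      shift by \<open>N\<close> discards the earlier indices.\<close>
    have "(\<lambda>n. LBINT y. exp (p y * complex_of_real (x (n + N))) * k y)
        \<longlonglongrightarrow> (LBINT y. exp (p y * complex_of_real t) * k y)"
    proof (rule integral_dominated_convergence)
      show "integrable lborel (\<lambda>y. exp (Re (p y) * (t / 2)) * norm (k y) + exp (Re (p y) * (2 * t)) * norm (k y))"
        using int[of "t / 2"] int[of "2 * t"] t by auto
      show "AE y in lborel. (\<lambda>n. exp (p y * complex_of_real (x (n + N))) * k y)
               \<longlonglongrightarrow> exp (p y * complex_of_real t) * k y"
        by (intro AE_I2 tendsto_intros LIMSEQ_ignore_initial_segment x)
      show "AE y in lborel. norm (exp (p y * complex_of_real (x (n + N))) * k y)
          \<le> exp (Re (p y) * (t / 2)) * norm (k y) + exp (Re (p y) * (2 * t)) * norm (k y)" for n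
      proof (rule AE_I2)
        fix y
        have xn: "t / 2 < x (n + N)" "x (n + N) < 2 * t" using N[of "n + N"] by auto
        have "exp (Re (p y) * x (n + N)) \<le> exp (Re (p y) * (t / 2)) + exp (Re (p y) * (2 * t))"
        proof (cases "Re (p y) \<ge> 0")
          case True
          then have "Re (p y) * x (n + N) \<le> Re (p y) * (2 * t)" using xn by (intro mult_left_mono) auto
          then show ?thesis by (simp add: add_increasing)
        next
          case False
          then have "Re (p y) * x (n + N) \<le> Re (p y) * (t / 2)" using xn by (intro mult_left_mono_neg) auto
          then show ?thesis by (simp add: add_increasing2)
        qed
        then show "norm (exp (p y * complex_of_real (x (n + N))) * k y)
          \<le> exp (Re (p y) * (t / 2)) * norm (k y) + exp (Re (p y) * (2 * t)) * norm (k y)"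
          by (simp add: norm_mult distrib_right[symmetric] mult_right_mono)
      qed
    qed measurable
    then show "(\<lambda>n. LBINT y. exp (p y * complex_of_real (x n)) * k y)
        \<longlonglongrightarrow> (LBINT y. exp (p y * complex_of_real t) * k y)"
      by (rule LIMSEQ_offset)
  qed
qed

section \<open>Cauchy's formula on a half plane\<close>

text \<open>Cauchy's integral formula on the rectangle with corners \<sigma> \<plusminus> iR and
  \<sigma> + R \<plusminus> iR. On the three sides off the line, |G| \<le> e and |w - s| \<ge> R/2;
  their total length is 4R, so they contribute at most 4R * e * 2/R = 8e. Hence decay of G without
  any rate suffices.\<close>

lemma half_plane_rectangle_bound:
  fixes G :: "complex \<Rightarrow> complex" and \<sigma> s e R :: real
  assumes hol: "G holomorphic_on {z. Re z > \<sigma>}" and cont: "continuous_on {z. Re z \<ge> \<sigma>} G"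
    and s: "s > \<sigma>" and R: "R > 0" "R \<ge> 2 * (s - \<sigma>)" "R \<ge> 2 * \<bar>\<sigma>\<bar>" and e: "e > 0"
    and small: "\<And>z. Re z \<ge> \<sigma> \<Longrightarrow> norm z \<ge> R / 2 \<Longrightarrow> norm (G z) \<le> e"
  shows "norm (integral {- R..R} (\<lambda>y. G (Complex \<sigma> y) / (s - Complex \<sigma> y)) - 2 * pi * G s) \<le> 8 * e"
proof -
  define S where "S = {z. Re z \<ge> \<sigma>}"
  define f where "f w = G w / (w - complex_of_real s)" for w
  define a1 a2 a3 a4 where "a1 = Complex \<sigma> (- R)" and "a2 = Complex (\<sigma> + R) (- R)"
    and "a3 = Complex (\<sigma> + R) R" and "a4 = Complex \<sigma> R"
  have rect: "rectpath a1 a3 = linepath a1 a2 +++ linepath a2 a3 +++ linepath a3 a4 +++ linepath a4 a1"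
    by (simp add: rectpath_def a1_def a2_def a3_def a4_def Let_def)
  have convS: "convex S" unfolding S_def by (rule convex_halfspace_Re_ge)
  have intS: "interior S = {z. Re z > \<sigma>}"
  proof -
    have "(1::complex) \<noteq> 0" by simp
    from interior_halfspace_ge[OF this, of \<sigma>] show ?thesis by (simp add: S_def)
  qed
  have sbox: "complex_of_real s \<in> box a1 a3"
    using s R by (simp add: in_box_complex_iff a1_def a3_def)
  have seg: "closed_segment a1 a2 \<subseteq> {z. Re z \<ge> \<sigma> \<and> Im z = - R}"
    "closed_segment a2 a3 \<subseteq> {z. Re z = \<sigma> + R}"
    "closed_segment a3 a4 \<subseteq> {z. Re z \<ge> \<sigma> \<and> Im z = R}"
    "closed_segment a4 a1 \<subseteq> {z. Re z = \<sigma>}"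
    using R(1) by (auto simp: a1_def a2_def a3_def a4_def closed_segment_same_Re closed_segment_same_Im
          closed_segment_eq_real_ivl split: if_splits)
  have sub: "closed_segment a1 a2 \<subseteq> S - {complex_of_real s}" "closed_segment a2 a3 \<subseteq> S - {complex_of_real s}"
    "closed_segment a3 a4 \<subseteq> S - {complex_of_real s}" "closed_segment a4 a1 \<subseteq> S - {complex_of_real s}"
    using seg R s by (fastforce simp: S_def)+
  have contf: "continuous_on (S - {complex_of_real s}) f"
    unfolding f_def by (intro continuous_intros continuous_on_subset[OF cont]) (auto simp: S_def)
  note ci = contour_integrable_continuous_linepath[OF continuous_on_subset[OF contf sub(1)]]
    contour_integrable_continuous_linepath[OF continuous_on_subset[OF contf sub(2)]]
    contour_integrable_continuous_linepath[OF continuous_on_subset[OF contf sub(3)]]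
    contour_integrable_continuous_linepath[OF continuous_on_subset[OF contf sub(4)]]
  have "(f has_contour_integral (2 * pi * \<i> * winding_number (rectpath a1 a3) s * G s)) (rectpath a1 a3)"
    unfolding f_def
  \<comment> \<open>This version wants differentiability in the interior and only continuity on the
    closed half plane, so the left side may lie on Re z = \<sigma>. For \<sigma> = 0 that line
    contains the branch point of the power.\<close>
  proof (rule Cauchy_integral_formula_convex[OF convS, of "{}"])
    show "G field_differentiable at x" if "x \<in> interior S - {}" for x
      using holomorphic_on_imp_differentiable_at[OF hol] that intS
      by (auto simp: open_halfspace_Re_gt)
    show "path_image (rectpath a1 a3) \<subseteq> S - {complex_of_real s}"
      unfolding rect using sub by (auto simp: path_image_join)
  qed (use cont s intS in \<open>auto simp: S_def\<close>)
  then have "contour_integral (rectpath a1 a3) f = 2 * pi * \<i> * G s"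
    by (simp add: contour_integral_unique winding_number_rectpath[OF sbox])
  then have sum: "contour_integral (linepath a1 a2) f + contour_integral (linepath a2 a3) f
     + contour_integral (linepath a3 a4) f + contour_integral (linepath a4 a1) f = 2 * pi * \<i> * G s"
    unfolding rect using ci by (simp add: add.assoc)
  have bd: "norm (f w) \<le> e * (2 / R)" if "Re w \<ge> \<sigma>" "\<bar>Im w\<bar> = R \<or> Re w = \<sigma> + R" for w
  proof -
    have "norm w \<ge> R / 2" "norm (w - s) \<ge> R / 2"
      using that abs_Im_le_cmod[of w] abs_Im_le_cmod[of "w - s"]
        complex_Re_le_cmod[of w] complex_Re_le_cmod[of "w - s"] R by auto
    then have "norm (G w) / norm (w - s) \<le> e / (R / 2)"
      using small[OF that(1)] R(1) e by (intro frac_le) auto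
    then show ?thesis by (simp add: f_def norm_divide)
  qed
  have n: "norm (a2 - a1) = R" "norm (a3 - a2) = 2 * R" "norm (a4 - a3) = R"
    using R(1) by (auto simp: a1_def a2_def a3_def a4_def cmod_def real_sqrt_mult)
  have "norm (contour_integral (linepath a1 a2) f) \<le> e * (2 / R) * norm (a2 - a1)"
    "norm (contour_integral (linepath a2 a3) f) \<le> e * (2 / R) * norm (a3 - a2)"
    "norm (contour_integral (linepath a3 a4) f) \<le> e * (2 / R) * norm (a4 - a3)"
    using ci seg e R(1) by (intro contour_integral_bound_linepath; fastforce intro!: bd)+
  then have b: "norm (contour_integral (linepath a1 a2) f) \<le> 2 * e"
    "norm (contour_integral (linepath a2 a3) f) \<le> 4 * e"
    "norm (contour_integral (linepath a3 a4) f) \<le> 2 * e"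
    using R(1) unfolding n by auto
  \<comment> \<open>The left side is traversed downwards; this sign cancels the one between
    \<open>w - s\<close> and \<open>s - w\<close>.\<close>
  have "contour_integral (linepath a4 a1) f = - contour_integral (linepath a1 a4) f"
    using contour_integral_reverse_linepath[of a4 a1 f] continuous_on_subset[OF contf sub(4)] by simp
  also have "contour_integral (linepath a1 a4) f = \<i> * integral {- R..R} (\<lambda>y. f (Complex \<sigma> y))"
    by (rule contour_integral_linepath_same_Re) (use R in \<open>auto simp: a1_def a4_def\<close>)
  also have "integral {- R..R} (\<lambda>y. f (Complex \<sigma> y))
      = integral {- R..R} (\<lambda>y. - (G (Complex \<sigma> y) / (s - Complex \<sigma> y)))"
    by (rule integral_cong) (simp add: f_def minus_divide_right)
  finally have l: "contour_integral (linepath a4 a1) f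
      = \<i> * integral {- R..R} (\<lambda>y. G (Complex \<sigma> y) / (s - Complex \<sigma> y))"
    by simp
  let ?I = "integral {- R..R} (\<lambda>y. G (Complex \<sigma> y) / (s - Complex \<sigma> y))"
  have "norm (?I - 2 * pi * G s) = norm (\<i> * (?I - 2 * pi * G s))"
    by (simp add: norm_mult)
  also have "\<i> * (?I - 2 * pi * G s) = - (contour_integral (linepath a1 a2) f
      + contour_integral (linepath a2 a3) f + contour_integral (linepath a3 a4) f)"
    using sum unfolding l by (simp add: algebra_simps eq_neg_iff_add_eq_0)
  also have "norm \<dots> \<le> 2 * e + 4 * e + 2 * e"
    unfolding norm_minus_cancel by (intro norm_triangle_mono b)
  finally show ?thesis by simp
qed

text \<open>The truncations to [-n, n] converge to the Lebesgue integral by dominated convergence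
  and to \<open>2 * pi * G s\<close> by the rectangle estimate.\<close>

lemma half_plane_Cauchy_formula:
  fixes G :: "complex \<Rightarrow> complex" and \<sigma> s :: real
  assumes hol: "G holomorphic_on {z. Re z > \<sigma>}" and cont: "continuous_on {z. Re z \<ge> \<sigma>} G"
    and s: "s > \<sigma>"
    and decay: "\<And>e. e > 0 \<Longrightarrow> \<exists>R. \<forall>z. Re z \<ge> \<sigma> \<longrightarrow> norm z \<ge> R \<longrightarrow> norm (G z) \<le> e"
    and int: "integrable lborel (\<lambda>y. G (Complex \<sigma> y) / (s - Complex \<sigma> y))"
  shows "(LBINT y. G (Complex \<sigma> y) / (s - Complex \<sigma> y)) = 2 * pi * G s"
proof -
  let ?h = "\<lambda>y. G (Complex \<sigma> y) / (complex_of_real s - Complex \<sigma> y)"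
  have "(\<lambda>n. LBINT y. indicator {- real n..real n} y *\<^sub>R ?h y) \<longlonglongrightarrow> (LBINT y. ?h y)"
  proof (rule integral_dominated_convergence[where w = "\<lambda>y. norm (?h y)"])
    show "AE y in lborel. (\<lambda>n. indicator {- real n..real n} y *\<^sub>R ?h y) \<longlonglongrightarrow> ?h y"
    proof (rule AE_I2, rule tendsto_eventually)
      fix y :: real
      obtain N where "\<bar>y\<bar> \<le> real N" using real_arch_simple by blast
      then show "\<forall>\<^sub>F n in sequentially. indicator {- real n..real n} y *\<^sub>R ?h y = ?h y"
        by (intro eventually_mono[OF eventually_ge_at_top[of N]]) (auto simp: indicator_def)
    qed
    show "AE y in lborel. norm (indicator {- real n..real n} y *\<^sub>R ?h y) \<le> norm (?h y)" for n
      by (auto simp: indicator_def)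
  qed (use int in auto)
  moreover have "(LBINT y. indicator {- real n..real n} y *\<^sub>R ?h y) = integral {- real n..real n} ?h" for n
  proof -
    have "set_integrable lborel {- real n..real n} ?h"
      unfolding set_integrable_def using int by (intro integrable_mult_indicator) auto
    from set_borel_integral_eq_integral(2)[OF this] show ?thesis
      by (simp add: set_lebesgue_integral_def)
  qed
  ultimately have 1: "(\<lambda>n. integral {- real n..real n} ?h) \<longlonglongrightarrow> (LBINT y. ?h y)" by simp
  have "(\<lambda>n. integral {- real n..real n} ?h) \<longlonglongrightarrow> 2 * pi * G s"
  proof (rule LIMSEQ_I)
    fix r :: real assume r: "r > 0"
    \<comment> \<open>The rectangle estimate costs a factor 8.\<close>
    obtain R where R: "\<And>z. Re z \<ge> \<sigma> \<Longrightarrow> norm z \<ge> R \<Longrightarrow> norm (G z) \<le> r / 9"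
      using decay[of "r / 9"] r by auto
    \<comment> \<open>The entry \<open>2 * R\<close> appears because the rectangle estimate asks for
      smallness from half the size of the rectangle on; the others are its size conditions.\<close>
    define K where "K = max (max 1 (2 * R)) (max (2 * (s - \<sigma>)) (2 * \<bar>\<sigma>\<bar>))"
    obtain N where N: "K \<le> real N" using real_arch_simple by blast
    have "norm (integral {- real n..real n} ?h - 2 * pi * G s) < r" if "n \<ge> N" for n
    proof -
      have n: "real n \<ge> K" using N that by linarith
      have "norm (integral {- real n..real n} ?h - 2 * pi * G s) \<le> 8 * (r / 9)"
      proof (rule half_plane_rectangle_bound[OF hol cont s])
        show "norm (G z) \<le> r / 9" if "Re z \<ge> \<sigma>" "norm z \<ge> real n / 2" for z
          by (rule R) (use that n in \<open>auto simp: K_def\<close>)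
      qed (use n r in \<open>auto simp: K_def\<close>)
      also have "\<dots> < r" using r by simp
      finally show ?thesis .
    qed
    then show "\<exists>no. \<forall>n\<ge>no. norm (integral {- real n..real n} ?h - 2 * pi * G s) < r" by blast
  qed
  from LIMSEQ_unique[OF 1 this] show ?thesis .
qed

section \<open>The Mittag-Leffler series\<close>

lemma laplace_powr:
  fixes \<nu> s :: real
  assumes "\<nu> > 0" "s > 0"
  shows "set_integrable lborel {0<..} (\<lambda>t. exp (- s * t) * t powr (\<nu> - 1))"
    and "(LBINT t:{0<..}. exp (- s * t) * t powr (\<nu> - 1)) = Gamma \<nu> * s powr (- \<nu>)"
proof -
  define f where "f t = indicator {0<..} t *\<^sub>R (exp (- t) * t powr (\<nu> - 1))" for t :: real
  have "((\<lambda>t. exp (- t) * t powr (\<nu> - 1)) has_integral Gamma \<nu>) {0..}"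
    using Gamma_integral_real[OF assms(1)] by (simp add: exp_minus field_simps)
  then have *: "((\<lambda>t. exp (- t) * t powr (\<nu> - 1)) has_integral Gamma \<nu>) {0<..}"
    by (rule has_integral_spike_set_eq[THEN iffD1, rotated 2])
       (auto intro!: negligible_subset[OF negligible_sing[of 0]])
  have m: "set_borel_measurable borel {0<..} (\<lambda>t. exp (- t) * t powr (\<nu> - 1))"
    unfolding set_borel_measurable_def by measurable
  have f: "integrable lborel f" "(LBINT t. f t) = Gamma \<nu>"
    using nonneg_has_integral_imp_LBINT[OF * _ m]
    by (simp_all add: f_def[abs_def] set_integrable_def set_lebesgue_integral_def)
  have fs: "s powr (1 - \<nu>) * f (0 + s * t) = indicator {0<..} t *\<^sub>R (exp (- s * t) * t powr (\<nu> - 1))" for t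
    using assms(2)
    by (auto simp: f_def indicator_def powr_mult zero_less_mult_iff powr_add[symmetric] mult.left_commute)
  have "integrable lborel (\<lambda>t. s powr (1 - \<nu>) * f (0 + s * t))"
    using f(1) assms(2) by (intro integrable_mult_right lborel_integrable_real_affine) auto
  then show "set_integrable lborel {0<..} (\<lambda>t. exp (- s * t) * t powr (\<nu> - 1))"
    unfolding fs set_integrable_def .
  have "(LBINT t:{0<..}. exp (- s * t) * t powr (\<nu> - 1)) = (LBINT t. s powr (1 - \<nu>) * f (0 + s * t))"
    unfolding fs set_lebesgue_integral_def ..
  also have "\<dots> = s powr (1 - \<nu>) * (Gamma \<nu> / s)"
    using lborel_integral_real_affine[of s f 0] assms(2) f(2) by simp
  also have "\<dots> = Gamma \<nu> * s powr (- \<nu>)"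
    using assms(2) by (simp add: powr_diff powr_minus field_simps)
  finally show "(LBINT t:{0<..}. exp (- s * t) * t powr (\<nu> - 1)) = Gamma \<nu> * s powr (- \<nu>)" .
qed

text \<open>Termwise integration, justified by \<open>sm\<close>, which sums the integrals of the
  absolute values. The exponents are arbitrary so that the kernel and its product with t^2 are both
  covered.\<close>

lemma laplace_powr_series:
  fixes c \<nu> :: "nat \<Rightarrow> real" and s :: real
  assumes \<nu>: "\<And>n. \<nu> n > 0" and s: "s > 0"
    and pt: "\<And>t. t > 0 \<Longrightarrow> summable (\<lambda>n. \<bar>c n\<bar> * t powr (\<nu> n - 1))"
    and sm: "summable (\<lambda>n. \<bar>c n\<bar> * (Gamma (\<nu> n) * s powr (- \<nu> n)))"
  shows "set_integrable lborel {0<..} (\<lambda>t. exp (- s * t) * (\<Sum>n. c n * t powr (\<nu> n - 1)))"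
    and "(LBINT t:{0<..}. exp (- s * t) * (\<Sum>n. c n * t powr (\<nu> n - 1)))
       = (\<Sum>n. c n * (Gamma (\<nu> n) * s powr (- \<nu> n)))"
proof -
  define w where "w n t = indicator {0<..} t *\<^sub>R (exp (- s * t) * t powr (\<nu> n - 1))" for n and t :: real
  have w: "integrable lborel (w n)" "(LBINT t. w n t) = Gamma (\<nu> n) * s powr (- \<nu> n)" for n
    using laplace_powr[OF \<nu>[of n] s]
    by (simp_all add: w_def[abs_def] set_integrable_def set_lebesgue_integral_def)
  have w0: "w n t \<ge> 0" for n t by (simp add: w_def)
  have nrm: "norm (c n * w n t) = \<bar>c n\<bar> * w n t" for n t
    using w0[of n t] by (simp add: abs_mult)
  have i: "integrable lborel (\<lambda>t. c n * w n t)" for n using w by simp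
  have ae: "AE t in lborel. summable (\<lambda>n. norm (c n * w n t))"
  proof (rule AE_I2)
    fix t :: real
    show "summable (\<lambda>n. norm (c n * w n t))"
    proof (cases "t > 0")
      case True
      then have "norm (c n * w n t) = exp (- s * t) * (\<bar>c n\<bar> * t powr (\<nu> n - 1))" for n
        by (simp only: nrm) (simp add: w_def)
      then show ?thesis using pt[OF True] by (simp add: summable_mult)
    qed (simp add: w_def)
  qed
  have sn: "summable (\<lambda>n. LBINT t. norm (c n * w n t))"
    unfolding nrm using sm w(2) by simp
  have e: "(\<Sum>n. c n * w n t) = indicator {0<..} t *\<^sub>R (exp (- s * t) * (\<Sum>n. c n * t powr (\<nu> n - 1)))" for t
  proof (cases "t > 0")
    case True
    have "summable (\<lambda>n. c n * t powr (\<nu> n - 1))"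
      by (rule summable_norm_cancel) (use pt[OF True] in \<open>simp add: abs_mult\<close>)
    moreover have "c n * w n t = exp (- s * t) * (c n * t powr (\<nu> n - 1))" for n
      using True by (simp add: w_def)
    ultimately have "(\<Sum>n. c n * w n t) = exp (- s * t) * (\<Sum>n. c n * t powr (\<nu> n - 1))"
      by (simp only: suminf_mult)
    then show ?thesis using True by simp
  qed (simp add: w_def)
  show "set_integrable lborel {0<..} (\<lambda>t. exp (- s * t) * (\<Sum>n. c n * t powr (\<nu> n - 1)))"
    using integrable_suminf[OF i ae sn] by (simp only: e set_integrable_def)
  show "(LBINT t:{0<..}. exp (- s * t) * (\<Sum>n. c n * t powr (\<nu> n - 1)))
       = (\<Sum>n. c n * (Gamma (\<nu> n) * s powr (- \<nu> n)))"
    using integral_suminf[OF i ae sn] by (simp add: e set_lebesgue_integral_def w(2))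
qed

text \<open>The Gamma integral is cut down to [X, \<infinity>), where t^(\<mu>-1) \<ge> X^(\<mu>-1).
  As X is free, Gamma outgrows every geometric sequence.\<close>

lemma Gamma_real_ge_powr:
  fixes \<mu> X :: real
  assumes "\<mu> \<ge> 1" "X > 0"
  shows "X powr (\<mu> - 1) * exp (- X) \<le> Gamma \<mu>"
proof (rule has_integral_le)
  have "((\<lambda>t. X powr (\<mu> - 1) * exp (- 1 * t)) has_integral X powr (\<mu> - 1) * (exp (- 1 * X) / 1)) {X..}"
    by (intro has_integral_mult_right has_integral_exp_minus_to_infinity) simp
  then show "((\<lambda>t. if t \<in> {X..} then X powr (\<mu> - 1) * exp (- 1 * t) else 0) has_integral
      X powr (\<mu> - 1) * exp (- X)) {0..}"
    using assms by (subst has_integral_restrict) auto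
  show "((\<lambda>t. t powr (\<mu> - 1) / exp t) has_integral Gamma \<mu>) {0..}"
    using assms by (intro Gamma_integral_real) auto
  show "(if t \<in> {X..} then X powr (\<mu> - 1) * exp (- 1 * t) else 0) \<le> t powr (\<mu> - 1) / exp t"
    if "t \<in> {0..}" for t
    using assms that by (auto simp: exp_minus field_simps intro!: powr_mono2)
qed

lemma summable_mittag_leffler:
  fixes a b r :: real
  assumes a: "a > 0" and b: "b > 0" and r: "r \<ge> 0"
  shows "summable (\<lambda>n. r ^ n / Gamma (b + a * real n))"
proof -
  \<comment> \<open>Chosen so that X^a = 2r + 1: the terms are then at most a constant times (r /
    (2r + 1))^n \<le> (1/2)^n. The summand 1 keeps X positive for r = 0.\<close>
  define X where "X = (2 * r + 1) powr (1 / a)"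
  have X: "X > 0" using r by (simp add: X_def)
  have Xa: "X powr (a * real n) = (2 * r + 1) ^ n" for n
    using r a by (simp add: X_def powr_powr powr_realpow)
  \<comment> \<open>From this index on the argument of Gamma is at least 1, as the lower bound
    requires.\<close>
  obtain N where N: "1 / a \<le> real N" using real_arch_simple by blast
  define C where "C = exp X / X powr (b - 1)"
  show ?thesis
  proof (rule summable_comparison_test_ev)
    show "\<forall>\<^sub>F n in sequentially. norm (r ^ n / Gamma (b + a * real n)) \<le> C * (1 / 2) ^ n"
    proof (rule eventually_mono[OF eventually_ge_at_top[of N]])
      fix n assume "n \<ge> N"
      then have "1 / a \<le> real n" using N by linarith
      then have "1 \<le> b + a * real n" using a b by (simp add: field_simps)
      from Gamma_real_ge_powr[OF this X]
      moreover have "X powr (b + a * real n - 1) = (2 * r + 1) ^ n * X powr (b - 1)"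
        unfolding Xa[symmetric] powr_add[symmetric] by (simp add: algebra_simps)
      ultimately have G: "(2 * r + 1) ^ n * (X powr (b - 1) * exp (- X)) \<le> Gamma (b + a * real n)"
        by (simp add: mult.assoc)
      have "norm (r ^ n / Gamma (b + a * real n)) = r ^ n / Gamma (b + a * real n)"
        using a b r by (simp add: Gamma_real_pos add_pos_nonneg)
      also have "\<dots> \<le> r ^ n / ((2 * r + 1) ^ n * (X powr (b - 1) * exp (- X)))"
        using G r X by (intro divide_left_mono mult_pos_pos) (auto intro!: Gamma_real_pos add_pos_nonneg mult_nonneg_nonneg simp: a b less_imp_le)
      also have "\<dots> = C * (r / (2 * r + 1)) ^ n"
        by (simp add: C_def power_divide exp_minus field_simps)
      also have "\<dots> \<le> C * (1 / 2) ^ n"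
        using r X by (intro mult_left_mono power_mono) (auto simp: C_def field_simps)
      finally show "norm (r ^ n / Gamma (b + a * real n)) \<le> C * (1 / 2) ^ n" .
    qed
    show "summable (\<lambda>n. C * (1 / 2) ^ n :: real)"
      by (intro summable_mult summable_geometric) auto
  qed
qed

lemma continuous_mittag_leffler_real:
  fixes a b x :: real
  assumes a: "a > 0" and b: "b > 0"
  shows "isCont (\<lambda>x. mittag_leffler a b x :: real) x"
proof -
  have "summable (\<lambda>n. inverse (Gamma (b + a * real n)) * (\<bar>x\<bar> + 1) ^ n)"
    using summable_mittag_leffler[OF a b, of "\<bar>x\<bar> + 1"] by (simp add: field_simps)
  from isCont_powser[OF this, of x] show ?thesis
    by (simp add: mittag_leffler_def)
qed

text \<open>In this arrangement t^(\<nu>-1) carries the coefficient \<plusminus>1/Gamma(\<nu>), so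
  each term has the Laplace transform \<plusminus>s^(-\<nu>).\<close>

lemma mittag_leffler_kernel_series:
  fixes a t :: real
  assumes a: "a > 0" and t: "t > 0"
  shows "summable (\<lambda>n. \<bar>(- 1) ^ n / Gamma (a * real (Suc n))\<bar> * t powr (a * real (Suc n) - 1))"
    and "t powr (a - 1) * mittag_leffler a a (- (t powr a))
       = (\<Sum>n. (- 1) ^ n / Gamma (a * real (Suc n)) * t powr (a * real (Suc n) - 1))"
proof -
  have p: "t powr (a * real (Suc n) - 1) = t powr (a - 1) * (t powr a) ^ n" for n
    using t by (simp add: powr_realpow[symmetric] powr_powr powr_add[symmetric] algebra_simps)
  have g: "Gamma (a * real (Suc n)) = Gamma (a + a * real n)" for n
    by (simp add: algebra_simps)
  have gp: "Gamma (a + a * real n) > 0" for n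
    using a by (intro Gamma_real_pos add_pos_nonneg) auto
  have s: "summable (\<lambda>n. (t powr a) ^ n / Gamma (a + a * real n))"
    by (rule summable_mittag_leffler[OF a a]) simp
  have 1: "\<bar>(- 1) ^ n / Gamma (a * real (Suc n))\<bar> * t powr (a * real (Suc n) - 1)
      = t powr (a - 1) * ((t powr a) ^ n / Gamma (a + a * real n))" for n
    unfolding p g using gp[of n] by simp
  show 2: "summable (\<lambda>n. \<bar>(- 1) ^ n / Gamma (a * real (Suc n))\<bar> * t powr (a * real (Suc n) - 1))"
    unfolding 1 by (rule summable_mult[OF s])
  have 3: "summable (\<lambda>n. (- (t powr a)) ^ n /\<^sub>R Gamma (a + a * real n))"
    by (rule summable_norm_cancel) (use s gp in \<open>simp add: abs_mult power_abs less_imp_le divide_inverse mult.commute\<close>)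
  have "(- 1) ^ n / Gamma (a * real (Suc n)) * t powr (a * real (Suc n) - 1)
      = t powr (a - 1) * ((- (t powr a)) ^ n /\<^sub>R Gamma (a + a * real n))" for n
    unfolding p g by (simp add: power_minus[of "t powr a"] divide_inverse)
  then show "t powr (a - 1) * mittag_leffler a a (- (t powr a))
       = (\<Sum>n. (- 1) ^ n / Gamma (a * real (Suc n)) * t powr (a * real (Suc n) - 1))"
    unfolding mittag_leffler_def by (simp only: suminf_mult[OF 3])
qed

lemma continuous_on_mittag_leffler_kernel:
  fixes a :: real
  assumes a: "a > 0"
  shows "continuous_on {0<..} (\<lambda>t. t powr (a - 1) * mittag_leffler a a (- (t powr a)) :: real)"
proof (intro continuous_on_mult)
  show "continuous_on {0<..} (\<lambda>t. mittag_leffler a a (- (t powr a)) :: real)"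
    by (rule continuous_on_compose2[of UNIV "mittag_leffler a a"])
       (use continuous_mittag_leffler_real[OF a a] in \<open>auto intro!: continuous_intros continuous_at_imp_continuous_on\<close>)
qed (auto intro!: continuous_intros)

text \<open>The Gamma factors cancel and leave a geometric series with ratio -s^(-a), which
  converges because s > 1.\<close>

lemma laplace_mittag_leffler_kernel:
  fixes a s :: real
  assumes a: "a > 0" and s: "s > 1"
  defines "f \<equiv> \<lambda>t. t powr (a - 1) * mittag_leffler a a (- (t powr a)) :: real"
  shows "set_integrable lborel {0<..} (\<lambda>t. exp (- s * t) * f t)"
    and "(LBINT t:{0<..}. exp (- s * t) * f t) = 1 / (1 + s powr a)"
proof -
  define c where "c n = (- 1) ^ n / Gamma (a * real (Suc n))" for n
  have gp: "Gamma (a * real (Suc n)) > 0" for n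
    using a by (intro Gamma_real_pos mult_pos_pos) auto
  define q where "q = s powr (- a)"
  have q: "0 < q" "q < 1" using s a by (auto simp: q_def powr_less_one)
  have sp: "s powr (- (a * real (Suc n))) = q * q ^ n" for n
    using s by (simp add: q_def powr_realpow[symmetric] powr_powr powr_add[symmetric] algebra_simps)
  have t1: "\<bar>c n\<bar> * (Gamma (a * real (Suc n)) * s powr (- (a * real (Suc n)))) = q * q ^ n" for n
    unfolding sp using gp[of n] by (simp add: c_def)
  have t2: "c n * (Gamma (a * real (Suc n)) * s powr (- (a * real (Suc n)))) = q * (- q) ^ n" for n
    unfolding sp using gp[of n] by (simp add: c_def power_minus[of q])
  have *: "summable (\<lambda>n. \<bar>c n\<bar> * (Gamma (a * real (Suc n)) * s powr (- (a * real (Suc n)))))"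
    unfolding t1 using q by (intro summable_mult summable_geometric) auto
  note L = laplace_powr_series[of "\<lambda>n. a * real (Suc n)" s c, OF _ _ _ *]
  have f: "indicator {0<..} t *\<^sub>R (exp (- s * t) * (\<Sum>n. c n * t powr (a * real (Suc n) - 1)))
    = indicator {0<..} t *\<^sub>R (exp (- s * t) * f t)" for t
    using mittag_leffler_kernel_series(2)[OF a, of t]
    by (cases "t > 0") (simp_all only: f_def c_def, simp)
  have "set_integrable lborel {0<..} (\<lambda>t. exp (- s * t) * (\<Sum>n. c n * t powr (a * real (Suc n) - 1)))"
    by (rule L(1)) (use a s mittag_leffler_kernel_series(1)[OF a] in \<open>auto simp: c_def\<close>)
  then show "set_integrable lborel {0<..} (\<lambda>t. exp (- s * t) * f t)"
    by (simp only: set_integrable_def f)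
  have "(LBINT t:{0<..}. exp (- s * t) * (\<Sum>n. c n * t powr (a * real (Suc n) - 1)))
     = (\<Sum>n. c n * (Gamma (a * real (Suc n)) * s powr (- (a * real (Suc n)))))"
    by (rule L(2)) (use a s mittag_leffler_kernel_series(1)[OF a] in \<open>auto simp: c_def\<close>)
  also have "\<dots> = q * (1 / (1 - (- q)))"
    unfolding t2 using q by (subst suminf_mult) (auto intro!: summable_geometric simp: suminf_geometric)
  also have "\<dots> = 1 / (1 + s powr a)"
    using s by (simp add: q_def powr_minus field_simps)
  finally show "(LBINT t:{0<..}. exp (- s * t) * f t) = 1 / (1 + s powr a)"
    by (simp only: set_lebesgue_integral_def f)
qed

section \<open>The function \<open>1 / (1 + z powr b)\<close> on a half plane\<close>

lemma norm_powr_of_real: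
  fixes z :: complex and b :: real
  shows "norm (z powr complex_of_real b) = norm z powr b"
  by (cases "z = 0") (auto simp: powr_def)

text \<open>Let w = z^b and \<rho> = |w|. The argument of w stays within pi b/2 < pi, so Re w \<ge>
  k \<rho> with k > -1. Then |1 + w|^2 \<ge> 1 + 2 k \<rho> + \<rho>^2 = (1+k)/2 (1+\<rho>)^2 +
  (1-k)/2 (1-\<rho>)^2, which explains the constant sqrt((1+k)/2).\<close>

lemma norm_one_plus_powr_ge:
  fixes b :: real
  assumes b: "0 < b" "b < 2"
  obtains c where "c > 0"
    "\<And>z. Re z \<ge> 0 \<Longrightarrow> c * (1 + norm z powr b) \<le> norm (1 + z powr complex_of_real b)"
proof -
  define k where "k = min 0 (cos (pi * b / 2))"
  have k: "- 1 < k" "k \<le> 0"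
    using cos_monotone_0_pi[of "pi * b / 2" pi] b by (auto simp: k_def)
  show thesis
  proof (rule that[of "sqrt ((1 + k) / 2)"])
    show "sqrt ((1 + k) / 2) > 0" using k by simp
    fix z :: complex assume z: "Re z \<ge> 0"
    define w where "w = z powr complex_of_real b"
    define \<rho> where "\<rho> = norm z powr b"
    have nw: "norm w = \<rho>" by (simp add: w_def \<rho>_def norm_powr_of_real)
    have \<rho>: "\<rho> \<ge> 0" by (simp add: \<rho>_def)
    have re: "Re w \<ge> \<rho> * k"
    proof (cases "z = 0")
      case False
      define \<theta> where "\<theta> = b * Im (Ln z)"
      have "\<bar>Im (Ln z)\<bar> \<le> pi / 2" using z Re_Ln_pos_le[OF False] by simp
      then have "\<bar>\<theta>\<bar> \<le> pi * b / 2"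
        using b mult_left_mono[of "\<bar>Im (Ln z)\<bar>" "pi / 2" b] by (simp add: \<theta>_def abs_mult mult.commute)
      then have "cos (pi * b / 2) \<le> cos \<bar>\<theta>\<bar>"
        using b by (intro cos_monotone_0_pi_le) auto
      then have "k \<le> cos \<theta>" by (simp add: k_def)
      moreover have "Re w = \<rho> * cos \<theta>"
        using False by (simp add: w_def powr_def Re_exp \<rho>_def \<theta>_def)
      ultimately show ?thesis using \<rho> by (simp add: mult_left_mono)
    qed (simp add: w_def \<rho>_def)
    have "norm (1 + w) ^ 2 = 1 + 2 * Re w + norm w ^ 2"
      by (simp add: cmod_power2) (simp add: power2_eq_square algebra_simps)
    then have 1: "norm (1 + w) ^ 2 \<ge> 1 + 2 * (\<rho> * k) + \<rho>\<^sup>2" using re nw by simp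
    have "(1 + k) / 2 * (1 + \<rho>) ^ 2 + (1 - k) / 2 * (1 - \<rho>) ^ 2 = 1 + 2 * (\<rho> * k) + \<rho>\<^sup>2"
      by (simp add: power2_eq_square field_simps)
    moreover have "(1 - k) / 2 * (1 - \<rho>) ^ 2 \<ge> 0" using k by simp
    ultimately have "(1 + k) / 2 * (1 + \<rho>) ^ 2 \<le> norm (1 + w) ^ 2" using 1 by linarith
    then have "sqrt ((1 + k) / 2 * (1 + \<rho>) ^ 2) \<le> norm (1 + w)"
      by (intro real_le_lsqrt) auto
    then show "sqrt ((1 + k) / 2) * (1 + norm z powr b) \<le> norm (1 + z powr complex_of_real b)"
      using \<rho> unfolding real_sqrt_mult by (simp add: \<rho>_def w_def)
  qed
qed

text \<open>A zero has modulus 1 and an argument of absolute value \<theta> with cos(a \<theta>) =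
  -1. Hence a \<theta> \<ge> pi, and Re z = cos \<theta> \<le> cos(pi/a) < \<sigma>.\<close>

lemma one_plus_powr_nonzero:
  fixes a \<sigma> :: real and z :: complex
  assumes a: "a > 1" and \<sigma>: "0 < \<sigma>" "cos (pi / a) < \<sigma>" and z: "Re z \<ge> \<sigma>"
  shows "1 + z powr complex_of_real a \<noteq> 0"
proof
  assume "1 + z powr complex_of_real a = 0"
  then have eq: "z powr complex_of_real a = - 1" by (simp add: eq_neg_iff_add_eq_0 add.commute)
  have z0: "z \<noteq> 0" "Re z > 0" using z \<sigma> by auto
  have "norm z powr a = 1"
    using norm_powr_of_real[of z a] eq by simp
  then have "a * ln (norm z) = 0"
    using ln_powr[of "norm z" a] z0 by simp
  then have nz: "norm z = 1" using a z0 by simp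
  define \<theta> where "\<theta> = \<bar>Im (Ln z)\<bar>"
  have \<theta>: "0 \<le> \<theta>" "\<theta> < pi / 2"
    using z0 Re_Ln_pos_lt[OF z0(1)] by (auto simp: \<theta>_def)
  have "Re (exp (complex_of_real a * Ln z)) = - 1"
    using eq z0 by (simp add: powr_def)
  then have ca: "cos (a * \<theta>) = - 1"
    using z0 nz a by (simp add: Re_exp \<theta>_def abs_if split: if_splits)
  have "pi \<le> a * \<theta>"
  proof (rule ccontr)
    assume "\<not> pi \<le> a * \<theta>"
    then have "cos pi < cos (a * \<theta>)"
      using \<theta> a by (intro cos_monotone_0_pi) auto
    then show False using ca by simp
  qed
  then have "cos \<theta> \<le> cos (pi / a)"
    using a \<theta> by (intro cos_monotone_0_pi_le) (auto simp: field_simps)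
  moreover have "Re z = cos \<theta>"
  proof -
    have "Re (exp (Ln z)) = cos \<theta>"
      unfolding Re_exp using z0 nz by (simp add: \<theta>_def abs_if)
    then show ?thesis using z0 by simp
  qed
  ultimately show False using \<sigma> z by simp
qed

lemma integrable_powr_tail:
  fixes \<phi> :: "real \<Rightarrow> complex" and b C R :: real
  assumes \<phi>: "continuous_on UNIV \<phi>" and b: "b > 1" and R: "R > 0"
    and bd: "\<And>y. \<bar>y\<bar> \<ge> R \<Longrightarrow> norm (\<phi> y) \<le> C * \<bar>y\<bar> powr (- b)"
  shows "integrable lborel \<phi>"
proof -
  define T where "T y = indicator {R..} y *\<^sub>R y powr (- b)" for y :: real
  have m: "set_borel_measurable borel {R..} (\<lambda>y. y powr (- b))"
    unfolding set_borel_measurable_def by measurable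
  have "((\<lambda>y. y powr (- b)) has_integral - (R powr (- b + 1)) / (- b + 1)) {R..}"
    using b R by (intro has_integral_powr_to_inf) auto
  from nonneg_has_integral_imp_LBINT(1)[OF this _ m] have T: "integrable lborel T"
    by (simp add: T_def[abs_def] set_integrable_def)
  have T': "integrable lborel (\<lambda>y. T (- y))"
    using lborel_integrable_real_affine[OF T, of "- 1" 0] by simp
  have I: "integrable lborel (\<lambda>y. indicator {- R..R} y *\<^sub>R norm (\<phi> y))"
    by (rule borel_integrable_compact) (auto intro!: continuous_intros continuous_on_subset[OF \<phi>])
  show ?thesis
  proof (rule Bochner_Integration.integrable_bound)
    show "integrable lborel (\<lambda>y. indicator {- R..R} y *\<^sub>R norm (\<phi> y) + C * (T y + T (- y)))"
      using I T T' by auto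
    show "\<phi> \<in> borel_measurable lborel"
      using \<phi> by (simp add: borel_measurable_continuous_onI)
    show "AE y in lborel. norm (\<phi> y)
        \<le> norm (indicator {- R..R} y *\<^sub>R norm (\<phi> y) + C * (T y + T (- y)))"
    proof (rule AE_I2)
      fix y
      \<comment> \<open>The sign of \<open>C\<close> is read off from the bound at y = R.\<close>
      have "0 \<le> C * R powr (- b)"
        using order.trans[OF norm_ge_zero bd[of R]] R by simp
      then have C: "C \<ge> 0" using R by (simp add: zero_le_mult_iff not_le)
      show "norm (\<phi> y) \<le> norm (indicator {- R..R} y *\<^sub>R norm (\<phi> y) + C * (T y + T (- y)))"
      proof (cases "\<bar>y\<bar> \<le> R")
        case True
        then have "y \<in> {- R..R}" by auto
        then show ?thesis using C by (auto simp: T_def intro!: order.trans[OF _ abs_ge_self])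
      next
        case False
        then show ?thesis using bd[of y] R C
          by (auto simp: T_def abs_if indicator_def split: if_splits intro!: order.trans[OF _ abs_ge_self])
      qed
    qed
  qed
qed

text \<open>The first power controls a neighbourhood of 0, the second the tails. With \<gamma> = a -
  2 this majorizes the second derivative of F on a vertical line, uniformly in the position of the
  line.\<close>

lemma integrable_min_powr:
  fixes \<gamma> :: real
  assumes \<gamma>: "\<gamma> > - 1"
  shows "integrable lborel (\<lambda>y::real. min (\<bar>y\<bar> powr \<gamma>) (\<bar>y\<bar> powr (- 2)))"
proof -
  define V where "V y = indicator {0..1} y *\<^sub>R y powr \<gamma> + indicator {1..} y *\<^sub>R y powr (- 2)" for y :: real
  have m: "set_borel_measurable borel {0..1} (\<lambda>y::real. y powr \<gamma>)"
    "set_borel_measurable borel {1..} (\<lambda>y::real. y powr (- 2))"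
    unfolding set_borel_measurable_def by measurable
  have h: "((\<lambda>y::real. y powr \<gamma>) has_integral 1 powr (\<gamma> + 1) / (\<gamma> + 1)) {0..1}"
    "((\<lambda>y::real. y powr (- 2)) has_integral - (1 powr (- 2 + 1)) / (- 2 + 1)) {1..}"
    using \<gamma> by (intro has_integral_powr_from_0 has_integral_powr_to_inf; simp)+
  have V: "integrable lborel V"
    using nonneg_has_integral_imp_LBINT(1)[OF h(1) _ m(1)] nonneg_has_integral_imp_LBINT(1)[OF h(2) _ m(2)]
    by (simp add: V_def[abs_def] set_integrable_def)
  have V': "integrable lborel (\<lambda>y. V (- y))"
    using lborel_integrable_real_affine[OF V, of "- 1" 0] by simp
  have V0: "V y \<ge> 0" for y by (simp add: V_def)
  show ?thesis
  proof (rule Bochner_Integration.integrable_bound)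
    show "integrable lborel (\<lambda>y. V y + V (- y))" using V V' by simp
    show "AE y in lborel. norm (min (\<bar>y\<bar> powr \<gamma>) (\<bar>y\<bar> powr (- 2))) \<le> norm (V y + V (- y))"
    proof (rule AE_I2)
      fix y :: real
      have "min (\<bar>y\<bar> powr \<gamma>) (\<bar>y\<bar> powr (- 2)) \<le> V \<bar>y\<bar>"
        by (auto simp: V_def indicator_def)
      also have "\<dots> \<le> V y + V (- y)" using V0[of y] V0[of "- y"] by (auto simp: abs_if)
      finally show "norm (min (\<bar>y\<bar> powr \<gamma>) (\<bar>y\<bar> powr (- 2))) \<le> norm (V y + V (- y))"
        by auto
    qed
  qed measurable
qed

text \<open>The case \<sigma> = 0 includes the branch point 0, where the positive exponent ensures
  continuity.\<close>

lemma continuous_on_powr_right_half_plane: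
  fixes b \<sigma> :: real
  assumes "b > 0" "\<sigma> \<ge> 0"
  shows "continuous_on {z. Re z \<ge> \<sigma>} (\<lambda>z. z powr complex_of_real b)"
  using assms by (intro continuous_intros) auto

text \<open>These are the hypotheses of Cauchy's formula. They are used for b = a on a line with
  \<sigma> > 0, and for b = 2a on the imaginary axis.\<close>

lemma inverse_one_plus_powr_half_plane:
  fixes b \<sigma> :: real
  assumes b: "b > 1" and \<sigma>: "\<sigma> \<ge> 0"
    and nz: "\<And>z. Re z \<ge> \<sigma> \<Longrightarrow> 1 + z powr complex_of_real b \<noteq> 0"
  defines "F \<equiv> \<lambda>z. 1 / (1 + z powr complex_of_real b)"
  shows "continuous_on {z. Re z \<ge> \<sigma>} F" "F holomorphic_on {z. Re z > \<sigma>}"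
    and "e > 0 \<Longrightarrow> \<exists>R. \<forall>z. norm z \<ge> R \<longrightarrow> norm (F z) \<le> e"
    and "integrable lborel (\<lambda>y. F (Complex \<sigma> y))"
proof -
  show c: "continuous_on {z. Re z \<ge> \<sigma>} F"
    unfolding F_def using nz b \<sigma>
    by (intro continuous_on_divide continuous_on_add continuous_on_powr_right_half_plane) (auto intro!: continuous_intros)
  show "F holomorphic_on {z. Re z > \<sigma>}"
    unfolding F_def using nz \<sigma>
    by (intro holomorphic_intros) (auto simp: complex_nonpos_Reals_iff less_imp_le)
  have bd: "norm (F z) \<le> 1 / (norm z powr b - 1)" if "norm z powr b > 1" for z
  proof -
    have "norm z powr b - 1 \<le> norm (1 + z powr complex_of_real b)"
      using norm_triangle_ineq4[of "1 + z powr complex_of_real b" 1] by (simp add: norm_powr_of_real)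
    then show ?thesis using that by (simp add: F_def norm_divide divide_left_mono frac_le)
  qed
  show "\<exists>R. \<forall>z. norm z \<ge> R \<longrightarrow> norm (F z) \<le> e" if e: "e > 0"
  proof (intro exI allI impI)
    \<comment> \<open>The radius at which |z|^b - 1 reaches 1/e.\<close>
    fix z :: complex assume "norm z \<ge> (1 + 1 / e) powr (1 / b)"
    then have "norm z powr b \<ge> ((1 + 1 / e) powr (1 / b)) powr b"
      using b by (intro powr_mono2) auto
    then have z: "norm z powr b \<ge> 1 + 1 / e" using b e by (simp add: powr_powr)
    then have "norm (F z) \<le> 1 / (norm z powr b - 1)"
      using e by (intro bd) (smt (verit) divide_pos_pos)
    also have "\<dots> \<le> 1 / (1 / e)" using z e by (intro divide_left_mono mult_pos_pos) (auto, smt (verit) divide_pos_pos)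
    finally show "norm (F z) \<le> e" by simp
  qed
  show "integrable lborel (\<lambda>y. F (Complex \<sigma> y))"
  \<comment> \<open>For |y| \<ge> 2 one has |y|^b \<ge> 2, so subtracting 1 loses at most half; this
    gives the constant 2.\<close>
  proof (rule integrable_powr_tail[OF _ b, of _ 2 2])
    show "continuous_on UNIV (\<lambda>y. F (Complex \<sigma> y))"
      by (rule continuous_on_compose2[OF c]) (auto intro!: continuous_intros simp: Complex_eq)
    fix y :: real assume y: "\<bar>y\<bar> \<ge> 2"
    have "2 powr 1 \<le> \<bar>y\<bar> powr b"
      using y b by (intro order.trans[OF powr_mono[of 1 b 2] powr_mono2]) auto
    moreover have "\<bar>y\<bar> powr b \<le> norm (Complex \<sigma> y) powr b"
      using b abs_Im_le_cmod[of "Complex \<sigma> y"] by (intro powr_mono2) auto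
    ultimately have 2: "norm (Complex \<sigma> y) powr b - 1 \<ge> \<bar>y\<bar> powr b / 2" "\<bar>y\<bar> powr b > 0" "norm (Complex \<sigma> y) powr b > 1"
      by auto
    have "norm (F (Complex \<sigma> y)) \<le> 1 / (norm (Complex \<sigma> y) powr b - 1)" using 2 by (intro bd)
    also have "\<dots> \<le> 1 / (\<bar>y\<bar> powr b / 2)"
      by (rule frac_le) (use 2 in linarith)+
    also have "\<dots> = 2 * \<bar>y\<bar> powr (- b)" unfolding powr_minus by (simp add: field_simps)
    finally show "norm (F (Complex \<sigma> y)) \<le> 2 * \<bar>y\<bar> powr (- b)" .
  qed simp
qed

section \<open>Complete monotonicity of Laplace transforms\<close>

text \<open>\<open>deriv\<close> sees only values near the point and (0, \<infinity>) is open, so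
  induction identifies the iterates of \<open>deriv\<close> with \<open>D n\<close> there, whatever
  f is elsewhere.\<close>

lemma completely_monotone_by_derivatives:
  fixes f :: "real \<Rightarrow> real" and D :: "nat \<Rightarrow> real \<Rightarrow> real"
  assumes D0: "\<And>x. x > 0 \<Longrightarrow> f x = D 0 x"
    and D: "\<And>n x. x > 0 \<Longrightarrow> (D n has_real_derivative D (Suc n) x) (at x)"
    and sgn: "\<And>n x. x > 0 \<Longrightarrow> 0 \<le> (- 1) ^ n * D n x"
  shows "completely_monotone f"
proof -
  have der: "((deriv ^^ n) f has_real_derivative D (Suc n) x) (at x)"
    if eq: "\<And>x. x > 0 \<Longrightarrow> (deriv ^^ n) f x = D n x" and "x > 0" for n x
    by (rule has_field_derivative_transform_within_open[OF D[OF \<open>x > 0\<close>] open_greaterThan[of 0]])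
       (use eq \<open>x > 0\<close> in auto)
  have eq: "(deriv ^^ n) f x = D n x" if "x > 0" for n x
    using that
  proof (induction n arbitrary: x)
    case (Suc n)
    then show ?case using DERIV_imp_deriv[OF der[OF Suc.IH]] by simp
  qed (use D0 in simp)
  show ?thesis
    unfolding completely_monotone_def
  proof (intro conjI allI impI)
    show "0 \<le> f x" if "x > 0" for x using sgn[of x 0] D0[OF that] that by simp
    show "(deriv ^^ n) f differentiable at x" if "x > 0" for n x
      using der[OF eq that] real_differentiable_def by blast
    show "0 \<le> (- 1) ^ n * (deriv ^^ n) f x" if "x > 0" for n x
      using sgn[OF that] eq[OF that] by simp
  qed
qed

lemma power_le_fact_mult_exp:
  fixes x :: real
  assumes "x \<ge> 0"
  shows "x ^ n \<le> fact n * exp x"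
proof -
  have "(\<Sum>i\<in>{n}. inverse (fact i) * x ^ i) \<le> (\<Sum>i. inverse (fact i) * x ^ i)"
    by (rule sum_le_suminf[OF summable_exp]) (use assms in auto)
  also have "\<dots> = exp x" by (simp add: exp_def divide_inverse mult.commute)
  finally show ?thesis by (simp add: field_simps)
qed

text \<open>Taylor remainder for differentiation under the integral. With x = q (u - t) it reduces
  to exp(-x) - 1 + x \<le> x^2 (1 + exp(-x)); for u > t/2 both resulting exponentials are at most
  exp(-q t/2), so apart from (u - t)^2 the bound is free of u.\<close>

lemma exp_second_order_bound:
  fixes q t u :: real
  assumes q: "q \<ge> 0" and t: "t > 0" and u: "u > t / 2"
  shows "\<bar>exp (- q * u) - exp (- q * t) + (u - t) * (q * exp (- q * t))\<bar>
    \<le> 2 * (u - t)\<^sup>2 * (q\<^sup>2 * exp (- q * (t / 2)))"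
proof -
  define x where "x = q * (u - t)"
  have u_eq: "exp (- q * u) = exp (- q * t) * exp (- x)"
    by (simp add: x_def exp_add[symmetric] algebra_simps)
  have 1: "1 - x \<le> exp (- x)" using exp_ge_add_one_self[of "- x"] by simp
  have "(1 + x) * exp (- x) \<le> exp x * exp (- x)"
    by (intro mult_right_mono exp_ge_add_one_self) simp
  then have 2: "(1 + x) * exp (- x) \<le> 1" by (simp add: exp_minus)
  have "exp (- x) - 1 + x \<le> x * (1 - exp (- x))" using 2 by (simp add: algebra_simps)
  also have "\<dots> \<le> x\<^sup>2 * (1 + exp (- x))"
  proof (cases "x \<ge> 0")
    case True
    then have "x * (1 - exp (- x)) \<le> x * x" using 1 by (intro mult_left_mono) auto
    also have "\<dots> \<le> x\<^sup>2 * (1 + exp (- x))" using mult_nonneg_nonneg[of "x * x" "exp (- x)"] by (simp add: power2_eq_square algebra_simps)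
    finally show ?thesis .
  next
    case False
    have "exp (- x) - 1 \<le> - x * exp (- x)" using 2 by (simp add: algebra_simps)
    then have "(- x) * (exp (- x) - 1) \<le> (- x) * (- x * exp (- x))"
      using False by (intro mult_left_mono) auto
    also have "\<dots> \<le> x\<^sup>2 * (1 + exp (- x))" by (simp add: power2_eq_square algebra_simps)
    finally show ?thesis by (simp add: algebra_simps)
  qed
  finally have 3: "\<bar>exp (- x) - 1 + x\<bar> \<le> x\<^sup>2 * (1 + exp (- x))" using 1 by simp
  have "exp (- q * u) - exp (- q * t) + (u - t) * (q * exp (- q * t))
      = exp (- q * t) * (exp (- x) - 1 + x)"
    unfolding u_eq by (simp add: x_def algebra_simps)
  also have "\<bar>\<dots>\<bar> \<le> exp (- q * t) * (x\<^sup>2 * (1 + exp (- x)))"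
    unfolding abs_mult using 3 by (intro mult_mono) auto
  also have "\<dots> = x\<^sup>2 * (exp (- q * t) + exp (- q * u))"
    unfolding u_eq by (simp add: algebra_simps)
  also have "\<dots> \<le> x\<^sup>2 * (exp (- q * (t / 2)) + exp (- q * (t / 2)))"
  proof (intro mult_left_mono add_mono)
    show "exp (- q * t) \<le> exp (- q * (t / 2))" using q t by (simp add: mult_left_mono)
    show "exp (- q * u) \<le> exp (- q * (t / 2))" using q u mult_left_mono[of "t / 2" u q] by simp
  qed simp
  also have "\<dots> = 2 * (u - t)\<^sup>2 * (q\<^sup>2 * exp (- q * (t / 2)))"
    by (simp add: x_def power_mult_distrib)
  finally show ?thesis .
qed

text \<open>The easy half of Bernstein's theorem: each derivative under the integral brings a factor
  \<open>- q y\<close>, so the n-th derivative has the sign (-1)^n.\<close>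

lemma completely_monotone_exp_mixture:
  fixes q k f :: "real \<Rightarrow> real"
  assumes [measurable]: "q \<in> borel_measurable borel" "k \<in> borel_measurable borel"
    and q: "\<And>y. q y \<ge> 0" and k: "\<And>y. k y \<ge> 0"
    and int: "\<And>t. t > 0 \<Longrightarrow> integrable lborel (\<lambda>y. exp (- q y * t) * k y)"
    and f: "\<And>t. t > 0 \<Longrightarrow> f t = (LBINT y. exp (- q y * t) * k y)"
  shows "completely_monotone f"
proof -
  define D where "D n t = (LBINT y. (- q y) ^ n * (exp (- q y * t) * k y))" for n t
  have I: "integrable lborel (\<lambda>y. q y ^ n * (exp (- q y * t) * k y))" if t: "t > 0" for n t
  proof (rule Bochner_Integration.integrable_bound)
    show "integrable lborel (\<lambda>y. fact n * (2 / t) ^ n * (exp (- q y * (t / 2)) * k y))"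
      using int[of "t / 2"] t by (intro integrable_mult_right) auto
    show "AE y in lborel. norm (q y ^ n * (exp (- q y * t) * k y))
        \<le> norm (fact n * (2 / t) ^ n * (exp (- q y * (t / 2)) * k y))"
    proof (rule AE_I2)
      fix y
      \<comment> \<open>Half of the exponential absorbs the power: q^n exp(-q t) \<le> n! (2/t)^n
        exp(-q t/2), which is integrable by the hypothesis at t/2.\<close>
      have "(q y * t / 2) ^ n \<le> fact n * exp (q y * t / 2)"
        using q[of y] t by (intro power_le_fact_mult_exp) auto
      then have "(2 / t) ^ n * (q y * t / 2) ^ n \<le> (2 / t) ^ n * (fact n * exp (q y * t / 2))"
        using t by (intro mult_left_mono) auto
      also have "(2 / t) ^ n * (q y * t / 2) ^ n = q y ^ n"
        unfolding power_mult_distrib[symmetric] using t by simp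
      finally have "q y ^ n * (exp (- q y * t) * k y) \<le> (2 / t) ^ n * (fact n * exp (q y * t / 2)) * (exp (- q y * t) * k y)"
        using k[of y] by (intro mult_right_mono) auto
      also have "\<dots> = fact n * (2 / t) ^ n * ((exp (q y * t / 2) * exp (- q y * t)) * k y)"
        by (simp only: ac_simps)
      also have "exp (q y * t / 2) * exp (- q y * t) = exp (- q y * (t / 2))"
        by (simp add: exp_add[symmetric])
      finally show "norm (q y ^ n * (exp (- q y * t) * k y)) \<le> norm (fact n * (2 / t) ^ n * (exp (- q y * (t / 2)) * k y))"
        using q[of y] k[of y] t by simp
    qed
  qed measurable
  have I': "integrable lborel (\<lambda>y. (- q y) ^ n * (exp (- q y * t) * k y))" if "t > 0" for n t
  proof -
    have "(- q y) ^ n * (exp (- q y * t) * k y) = (- 1) ^ n * (q y ^ n * (exp (- q y * t) * k y))" for y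
      by (simp add: power_minus[of "q y"])
    then show ?thesis using integrable_mult_right[OF I[OF that, of n], of "(- 1) ^ n"] by (simp only:)
  qed
  show ?thesis
  proof (rule completely_monotone_by_derivatives[where D = D])
    show "f x = D 0 x" if "x > 0" for x using f[OF that] by (simp add: D_def)
    show "0 \<le> (- 1) ^ n * D n x" if "x > 0" for n x
    proof -
      have "(- 1) ^ n * D n x = (LBINT y. (- 1) ^ n * ((- q y) ^ n * (exp (- q y * x) * k y)))"
        unfolding D_def by simp
      also have "\<dots> = (LBINT y. q y ^ n * (exp (- q y * x) * k y))"
        by (simp add: mult.assoc[symmetric] power_mult_distrib[symmetric])
      also have "\<dots> \<ge> 0" using q k by simp
      finally show ?thesis .
    qed
    fix n and t :: real assume t: "t > 0"
    \<comment> \<open>Evaluating at t/2 makes \<open>M\<close> independent of u, so the error of the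
      difference quotient is O(|u - t|).\<close>
    define M where "M = 2 * (LBINT y. q y ^ (n + 2) * (exp (- q y * (t / 2)) * k y))"
    have bd: "\<bar>(D n u - D n t) / (u - t) - D (Suc n) t\<bar> \<le> M * \<bar>u - t\<bar>"
      if u: "u > t / 2" "u \<noteq> t" for u
    proof -
      have u0: "u > 0" using u t by simp
      let ?\<phi> = "\<lambda>y. (- q y) ^ n * (exp (- q y * u) * k y) - (- q y) ^ n * (exp (- q y * t) * k y)
          - (u - t) * ((- q y) ^ Suc n * (exp (- q y * t) * k y))"
      have alg: "P * (A * K) - P * (B * K) - d * ((- Q * P) * (B * K)) = P * K * (A - B + d * (Q * B))"
        for P A B K d Q :: real
        by (simp add: algebra_simps)
      have i1: "integrable lborel ?\<phi>"
        by (intro Bochner_Integration.integrable_diff integrable_mult_right I' u0 t)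
      have i2: "integrable lborel (\<lambda>y. 2 * (u - t)\<^sup>2 * (q y ^ (n + 2) * (exp (- q y * (t / 2)) * k y)))"
        using t by (intro integrable_mult_right I) auto
      have pb: "\<bar>?\<phi> y\<bar> \<le> 2 * (u - t)\<^sup>2 * (q y ^ (n + 2) * (exp (- q y * (t / 2)) * k y))" for y
      proof -
        let ?E = "exp (- q y * u) - exp (- q y * t) + (u - t) * (q y * exp (- q y * t))"
        have "?\<phi> y = (- q y) ^ n * k y * ?E"
          unfolding power_Suc by (rule alg)
        then have "\<bar>?\<phi> y\<bar> = q y ^ n * k y * \<bar>?E\<bar>"
          using q[of y] k[of y] by (simp only: abs_mult power_abs abs_minus_cancel abs_of_nonneg)
        also have "\<dots> \<le> q y ^ n * k y * (2 * (u - t)\<^sup>2 * ((q y)\<^sup>2 * exp (- q y * (t / 2))))"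
          using q[of y] k[of y] by (intro mult_left_mono exp_second_order_bound t u) auto
        also have "\<dots> = 2 * (u - t)\<^sup>2 * (q y ^ (n + 2) * (exp (- q y * (t / 2)) * k y))"
          unfolding power_add by (simp only: ac_simps)
        finally show ?thesis .
      qed
      have diff: "D n u - D n t - (u - t) * D (Suc n) t = (LBINT y. ?\<phi> y)"
        unfolding D_def
        by (subst Bochner_Integration.integral_diff | subst integral_mult_right_zero |
            (intro Bochner_Integration.integrable_diff integrable_mult_right I' u0 t) | rule refl)+
      have "\<bar>D n u - D n t - (u - t) * D (Suc n) t\<bar> \<le> (LBINT y. \<bar>?\<phi> y\<bar>)"
        unfolding diff by (rule integral_abs_bound)
      also have "\<dots> \<le> (LBINT y. 2 * (u - t)\<^sup>2 * (q y ^ (n + 2) * (exp (- q y * (t / 2)) * k y)))"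
        using integrable_abs[OF i1] i2 pb by (rule integral_mono)
      also have "\<dots> = M * (\<bar>u - t\<bar> * \<bar>u - t\<bar>)" by (simp add: M_def power2_eq_square)
      finally have main: "\<bar>D n u - D n t - (u - t) * D (Suc n) t\<bar> \<le> M * \<bar>u - t\<bar> * \<bar>u - t\<bar>" by simp
      have "(D n u - D n t) / (u - t) - D (Suc n) t = (D n u - D n t - (u - t) * D (Suc n) t) / (u - t)"
        using u(2) by (simp add: field_simps)
      then show ?thesis using main u(2) by (simp add: pos_divide_le_eq)
    qed
    show "(D n has_real_derivative D (Suc n) t) (at t)"
      unfolding has_field_derivative_iff
    proof (rule LIM_zero_cancel, rule Lim_null_comparison)
      show "\<forall>\<^sub>F u in at t. norm ((D n u - D n t) / (u - t) - D (Suc n) t) \<le> M * \<bar>u - t\<bar>"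
      proof -
        have "\<forall>\<^sub>F u in at t. u \<in> {t / 2<..}"
          using t by (intro eventually_at_in_open') auto
        moreover have "\<forall>\<^sub>F u in at t. u \<noteq> t" by (simp add: eventually_at_filter)
        ultimately show ?thesis by eventually_elim (use bd in auto)
      qed
      show "((\<lambda>u. M * \<bar>u - t\<bar>) \<longlongrightarrow> 0) (at t)"
        by (rule tendsto_eq_intros refl tendsto_ident_at | simp)+
    qed
  qed
qed

lemma completely_monotone_exp: "completely_monotone (\<lambda>t. exp (- t))"
  by (rule completely_monotone_by_derivatives[where D = "\<lambda>n t. (- 1) ^ n * exp (- t)"])
     (auto intro!: derivative_eq_intros simp: mult.assoc[symmetric] power_mult_distrib[symmetric])

text \<open>Needed for a = 1, where the kernel is identified with exp(-t) only for t > 0.\<close>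

lemma completely_monotone_cong:
  assumes "\<And>x. x > 0 \<Longrightarrow> f x = g x" and g: "completely_monotone g"
  shows "completely_monotone f"
proof (rule completely_monotone_by_derivatives[where D = "\<lambda>n. (deriv ^^ n) g"])
  show "((deriv ^^ n) g has_real_derivative (deriv ^^ Suc n) g x) (at x)" if "x > 0" for n x
    using g that by (simp add: completely_monotone_def DERIV_deriv_iff_real_differentiable)
  show "0 \<le> (- 1) ^ n * (deriv ^^ n) g x" if "x > 0" for n x
    using g that by (cases "n = 0") (auto simp: completely_monotone_def)
qed (use assms in simp)

section \<open>Integral representations\<close>

abbreviation ml_kernel :: "real \<Rightarrow> real \<Rightarrow> real" where
  "ml_kernel a t \<equiv> t powr (a - 1) * mittag_leffler a a (- (t powr a))"

text \<open>The transfer step: \<open>h\<close> and the mixture have the same transform beyond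
  \<open>max s1 \<sigma>\<close>, hence coincide on (0, \<infinity>). What is known of the mixture
  for all s > \<sigma> then holds for \<open>h\<close>, even where s \<le>
  \<open>s1\<close>.\<close>

lemma laplace_mixture_representation:
  fixes p k :: "real \<Rightarrow> complex" and h L :: "real \<Rightarrow> real" and \<sigma> s1 :: real
  assumes ch: "continuous_on {0<..} h"
    and hi: "\<And>s. s > s1 \<Longrightarrow> set_integrable lborel {0<..} (\<lambda>t. exp (- s * t) * h t)"
    and hL: "\<And>s. s > s1 \<Longrightarrow> (LBINT t:{0<..}. exp (- s * t) * h t) = L s"
    and m: "p \<in> borel_measurable borel" "k \<in> borel_measurable borel"
    and ps: "\<And>y. Re (p y) \<le> \<sigma>"
    and intk: "\<And>t. t > 0 \<Longrightarrow> integrable lborel (\<lambda>y. exp (Re (p y) * t) * norm (k y))"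
    and int: "\<And>s. s > \<sigma> \<Longrightarrow> integrable lborel (\<lambda>y. norm (k y) / (s - Re (p y)))"
    and eq: "\<And>s. s > \<sigma> \<Longrightarrow> (LBINT y. k y / (s - p y)) = complex_of_real (L s)"
  shows "t > 0 \<Longrightarrow> h t = Re (LBINT y. exp (p y * complex_of_real t) * k y)"
    and "s > \<sigma> \<Longrightarrow> set_integrable lborel {0<..} (\<lambda>t. exp (- s * t) * h t)"
    and "s > \<sigma> \<Longrightarrow> (LBINT t:{0<..}. exp (- s * t) * h t) = L s"
proof -
  define g where "g t = Re (LBINT y. exp (p y * complex_of_real t) * k y)" for t
  have Lg: "set_integrable lborel {0<..} (\<lambda>t. exp (- s * t) * g t)"
    "(LBINT t:{0<..}. exp (- s * t) * g t) = L s" if s: "s > \<sigma>" for s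
  proof -
    have ps': "Re (p y) < s" for y using ps[of y] s by simp
    show "set_integrable lborel {0<..} (\<lambda>t. exp (- s * t) * g t)"
      "(LBINT t:{0<..}. exp (- s * t) * g t) = L s"
      using exp_mixture_laplace[OF m ps' int[OF s]] unfolding g_def eq[OF s] by simp_all
  qed
  have cg: "continuous_on {0<..} g"
    unfolding g_def by (intro continuous_on_Re continuous_on_exp_mixture m intk)
  have hg: "h t = g t" if "t > 0" for t
    by (rule laplace_inj[of _ _ "max s1 \<sigma>", OF ch cg _ _ _ that]) (use Lg hi hL in auto)
  then show "t > 0 \<Longrightarrow> h t = Re (LBINT y. exp (p y * complex_of_real t) * k y)"
    by (simp add: g_def)
  have e: "indicator {0<..} t *\<^sub>R (exp (- s * t) * h t) = indicator {0<..} t *\<^sub>R (exp (- s * t) * g t)" for s t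
    using hg[of t] by (cases "t > 0") auto
  show "s > \<sigma> \<Longrightarrow> set_integrable lborel {0<..} (\<lambda>t. exp (- s * t) * h t)"
    "s > \<sigma> \<Longrightarrow> (LBINT t:{0<..}. exp (- s * t) * h t) = L s"
    using Lg[of s] unfolding set_integrable_def set_lebesgue_integral_def e by blast+
qed

lemma Complex_borel_measurable [measurable]: "Complex \<sigma> \<in> borel_measurable borel"
  by (rule borel_measurable_continuous_onI) (auto simp: Complex_eq intro!: continuous_intros)

text \<open>The transfer step for \<open>p = Complex \<sigma>\<close> with weight G / (2 pi). The
  bound on \<open>h\<close> moves the absolute value inside the inversion integral, where |exp(p t)|
  = exp(\<sigma> t) is constant.\<close>

lemma Bromwich_representation:
  fixes G :: "complex \<Rightarrow> complex" and h L :: "real \<Rightarrow> real" and \<sigma> s1 :: real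
  assumes ch: "continuous_on {0<..} h"
    and hi: "\<And>s. s > s1 \<Longrightarrow> set_integrable lborel {0<..} (\<lambda>t. exp (- s * t) * h t)"
    and hL: "\<And>s. s > s1 \<Longrightarrow> (LBINT t:{0<..}. exp (- s * t) * h t) = L s"
    and cont: "continuous_on {z. Re z \<ge> \<sigma>} G" and hol: "G holomorphic_on {z. Re z > \<sigma>}"
    and decay: "\<And>e. e > 0 \<Longrightarrow> \<exists>R. \<forall>z. Re z \<ge> \<sigma> \<longrightarrow> norm z \<ge> R \<longrightarrow> norm (G z) \<le> e"
    and int: "integrable lborel (\<lambda>y. G (Complex \<sigma> y))"
    and GL: "\<And>s. s > \<sigma> \<Longrightarrow> G (complex_of_real s) = complex_of_real (L s)"
  shows "t > 0 \<Longrightarrow> \<bar>h t\<bar> \<le> exp (\<sigma> * t) / (2 * pi) * (LBINT y. norm (G (Complex \<sigma> y)))"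
    and "s > \<sigma> \<Longrightarrow> set_integrable lborel {0<..} (\<lambda>t. exp (- s * t) * h t)"
    and "s > \<sigma> \<Longrightarrow> (LBINT t:{0<..}. exp (- s * t) * h t) = L s"
proof -
  define k where "k y = G (Complex \<sigma> y) / (2 * pi)" for y
  have ik: "integrable lborel k" unfolding k_def[abs_def] using int by simp
  have mk: "k \<in> borel_measurable borel" using ik by auto
  have ikn: "integrable lborel (\<lambda>y. exp (Re (Complex \<sigma> y) * t) * norm (k y))"
    "integrable lborel (\<lambda>y. norm (k y) / (s - Re (Complex \<sigma> y)))" for s t
    using ik by simp_all
  have eq: "(LBINT y. k y / (s - Complex \<sigma> y)) = complex_of_real (L s)" if s: "s > \<sigma>" for s
  proof -
    have "integrable lborel (\<lambda>y. G (Complex \<sigma> y) / (complex_of_real s - Complex \<sigma> y))"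
    proof (rule Bochner_Integration.integrable_bound)
      show "integrable lborel (\<lambda>y. G (Complex \<sigma> y) / complex_of_real (s - \<sigma>))" using int by simp
      have [measurable]: "(\<lambda>y. G (Complex \<sigma> y)) \<in> borel_measurable borel" using int by auto
      show "(\<lambda>y. G (Complex \<sigma> y) / (complex_of_real s - Complex \<sigma> y)) \<in> borel_measurable lborel"
        by measurable
      have "s - \<sigma> \<le> norm (complex_of_real s - Complex \<sigma> y)" for y
        using complex_Re_le_cmod[of "complex_of_real s - Complex \<sigma> y"] by simp
      moreover from this have "0 < norm (complex_of_real s - Complex \<sigma> y)" for y
        using s by (meson diff_gt_0_iff_gt less_le_trans)
      ultimately show "AE y in lborel. norm (G (Complex \<sigma> y) / (complex_of_real s - Complex \<sigma> y))
          \<le> norm (G (Complex \<sigma> y) / complex_of_real (s - \<sigma>))"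
        using s unfolding norm_divide norm_of_real by (intro AE_I2 divide_left_mono mult_pos_pos) simp_all
    qed
    from half_plane_Cauchy_formula[OF hol cont s decay this]
    have 1: "(LBINT y. G (Complex \<sigma> y) / (complex_of_real s - Complex \<sigma> y)) = 2 * pi * G s" by blast
    have 2: "k y / (s - Complex \<sigma> y) = G (Complex \<sigma> y) / (complex_of_real s - Complex \<sigma> y) / (2 * pi)" for y
      by (simp add: k_def)
    show ?thesis unfolding 2 integral_divide_zero 1 using GL[OF s] by simp
  qed
  note rep = laplace_mixture_representation[OF ch hi hL Complex_borel_measurable mk _ ikn(1) ikn(2) eq]
  show "s > \<sigma> \<Longrightarrow> set_integrable lborel {0<..} (\<lambda>t. exp (- s * t) * h t)"
    by (rule rep(2)) auto
  show "s > \<sigma> \<Longrightarrow> (LBINT t:{0<..}. exp (- s * t) * h t) = L s"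
    by (rule rep(3)) auto
  show "\<bar>h t\<bar> \<le> exp (\<sigma> * t) / (2 * pi) * (LBINT y. norm (G (Complex \<sigma> y)))" if t: "t > 0"
  proof -
    have "h t = Re (LBINT y. exp (Complex \<sigma> y * complex_of_real t) * k y)"
      by (rule rep(1)) (use t in auto)
    then have "\<bar>h t\<bar> \<le> norm (LBINT y. exp (Complex \<sigma> y * complex_of_real t) * k y)"
      by (simp only: abs_Re_le_cmod)
    also have "\<dots> \<le> (LBINT y. norm (exp (Complex \<sigma> y * complex_of_real t) * k y))"
      by (rule integral_norm_bound)
    also have "\<dots> = (LBINT y. exp (\<sigma> * t) / (2 * pi) * norm (G (Complex \<sigma> y)))"
      by (simp add: norm_mult norm_divide k_def)
    also have "\<dots> = exp (\<sigma> * t) / (2 * pi) * (LBINT y. norm (G (Complex \<sigma> y)))"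
      by (rule integral_mult_right_zero)
    finally show ?thesis .
  qed
qed

lemma ml_kernel_laplace_gt_1:
  fixes a s :: real
  assumes a: "a > 1" and s: "s > 0" "cos (pi / a) < s"
  shows "set_integrable lborel {0<..} (\<lambda>t. exp (- s * t) * ml_kernel a t)"
    and "(LBINT t:{0<..}. exp (- s * t) * ml_kernel a t) = 1 / (1 + s powr a)"
proof -
  \<comment> \<open>The midpoint lies strictly to the right of all zeros of the denominator and
    strictly to the left of s.\<close>
  define \<sigma> where "\<sigma> = (max 0 (cos (pi / a)) + s) / 2"
  have \<sigma>: "0 < \<sigma>" "cos (pi / a) < \<sigma>" "\<sigma> < s" using s by (auto simp: \<sigma>_def)
  define F where "F z = 1 / (1 + z powr complex_of_real a)" for z
  note F = inverse_one_plus_powr_half_plane[OF a less_imp_le[OF \<sigma>(1)] one_plus_powr_nonzero[OF a \<sigma>(1,2)],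
      folded F_def]
  have a0: "a > 0" using a by simp
  have FL: "F (complex_of_real s) = complex_of_real (1 / (1 + s powr a))" if "s > \<sigma>" for s
    using that \<sigma> by (simp add: F_def powr_of_real)
  have decay: "\<exists>R. \<forall>z. Re z \<ge> \<sigma> \<longrightarrow> norm z \<ge> R \<longrightarrow> norm (F z) \<le> e" if "e > 0" for e
    using F(3)[of e] that by blast
  have F': "continuous_on {z. Re z \<ge> \<sigma>} F" "F holomorphic_on {z. Re z > \<sigma>}"
    "integrable lborel (\<lambda>y. F (Complex \<sigma> y))"
    using F(1,2,4) by blast+
  note B = Bromwich_representation[OF continuous_on_mittag_leffler_kernel[OF a0]
      laplace_mittag_leffler_kernel[OF a0] F'(1,2) decay F'(3) FL]
  show "set_integrable lborel {0<..} (\<lambda>t. exp (- s * t) * ml_kernel a t)"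
    by (rule B(2)) (use \<sigma> in auto)
  show "(LBINT t:{0<..}. exp (- s * t) * ml_kernel a t) = 1 / (1 + s powr a)"
    by (rule B(3)) (use \<sigma> in auto)
qed

section \<open>Stieltjes representation for 1/2 < a < 1\<close>

text \<open>The argument \<theta> of z lies in [-pi/2, pi/2], so b \<theta> stays in [-pi, pi],
  where the sine has the sign of the angle. On the imaginary axis this yields the sign of the
  Stieltjes weight.\<close>

lemma Im_mult_Im_powr_nonneg:
  fixes z :: complex and b :: real
  assumes z: "Re z \<ge> 0" and b: "0 < b" "b \<le> 2"
  shows "Im z * Im (z powr complex_of_real b) \<ge> 0"
proof (cases "z = 0")
  case False
  define \<theta> where "\<theta> = Im (Ln z)"
  have \<theta>: "\<bar>\<theta>\<bar> \<le> pi / 2" using z Re_Ln_pos_le[OF False] by (simp add: \<theta>_def)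
  have b\<theta>: "b * \<bar>\<theta>\<bar> \<le> pi"
    using mult_mono[of b 2 "\<bar>\<theta>\<bar>" "pi / 2"] \<theta> b by simp
  have im: "Im (z powr complex_of_real b) = norm z powr b * sin (b * \<theta>)"
    using False by (simp add: powr_def Im_exp \<theta>_def)
  have sg: "0 \<le> Im z \<longleftrightarrow> 0 \<le> \<theta>"
    using Im_Ln_pos_le[OF False] \<theta> by (auto simp: \<theta>_def)
  show ?thesis
  proof (cases "\<theta> \<ge> 0")
    case True
    then have "sin (b * \<theta>) \<ge> 0" using b\<theta> b by (intro sin_ge_zero) auto
    then show ?thesis using True sg by (simp add: im)
  next
    case neg: False
    then have "sin (b * (- \<theta>)) \<ge> 0" using b\<theta> b by (intro sin_ge_zero) (auto simp: mult_le_0_iff)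
    then show ?thesis using neg sg by (auto simp: im mult_le_0_iff zero_le_mult_iff)
  qed
qed simp

text \<open>In the coordinate \<open>w = sqrt s\<close> the slit plane becomes the right half plane, whose boundary is the
  slit; Cauchy's formula for \<open>2 * w / (w + w0) * 1 / (1 + w powr (2 * a))\<close> at \<open>w0\<close> is then the
  Stieltjes representation of \<open>1 / (1 + s powr a)\<close>.\<close>

lemma inverse_one_plus_powr_Stieltjes:
  fixes a :: real
  assumes a: "1/2 < a" "a < 1"
  defines "k \<equiv> \<lambda>y. \<i> * complex_of_real y / (pi * (1 + Complex 0 y powr complex_of_real (2 * a)))"
  shows "k \<in> borel_measurable borel" and "Re (k y) \<ge> 0"
    and "t > 0 \<Longrightarrow> integrable lborel (\<lambda>y. exp (- (y\<^sup>2) * t) * norm (k y))"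
    and "s > 0 \<Longrightarrow> integrable lborel (\<lambda>y. norm (k y) / (s + y\<^sup>2))"
    and "s > 0 \<Longrightarrow> (LBINT y. k y / (s + complex_of_real (y\<^sup>2))) = complex_of_real (1 / (1 + s powr a))"
proof -
  define F where "F z = 1 / (1 + z powr complex_of_real (2 * a))" for z
  have nz: "1 + z powr complex_of_real (2 * a) \<noteq> 0" if z: "Re z \<ge> 0" for z
  proof -
    obtain c where c: "c > 0"
      "\<And>z. Re z \<ge> 0 \<Longrightarrow> c * (1 + norm z powr (2 * a)) \<le> norm (1 + z powr complex_of_real (2 * a))"
      by (rule norm_one_plus_powr_ge[of "2 * a"]) (use a in auto)
    have "c * (1 + norm z powr (2 * a)) > 0" using c(1) by (intro mult_pos_pos add_pos_nonneg) auto
    then show ?thesis using c(2)[OF z] by auto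
  qed
  have "2 * a > 1" using a by simp
  note F = inverse_one_plus_powr_half_plane[OF this order_refl nz, folded F_def]
  have k: "k y = \<i> * complex_of_real y * F (Complex 0 y) / pi" for y
    by (simp add: k_def F_def)
  have nk: "norm (k y) = \<bar>y\<bar> * norm (F (Complex 0 y)) / pi" for y
    by (simp add: k norm_mult norm_divide)
  have [measurable]: "(\<lambda>y. F (Complex 0 y)) \<in> borel_measurable borel" using F(4) by auto
  show mk[measurable]: "k \<in> borel_measurable borel"
    unfolding k[abs_def] by measurable
  show "Re (k y) \<ge> 0"
  proof -
    define w where "w = Complex 0 y powr complex_of_real (2 * a)"
    have "y * Im w \<ge> 0"
      using Im_mult_Im_powr_nonneg[of "Complex 0 y" "2 * a"] a by (simp add: w_def)
    moreover have "Re (k y) = y * Im w / ((1 + Re w)\<^sup>2 + (Im w)\<^sup>2) / pi"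
    proof -
      have "k y = \<i> * complex_of_real y / (1 + w) / complex_of_real pi"
        by (simp add: k F_def w_def)
      then show ?thesis by (simp only: Re_divide_of_real) (simp add: Re_divide)
    qed
    ultimately show ?thesis by simp
  qed
  \<comment> \<open>\<open>k y\<close> is, up to constants, y times the integrable F(iy); the
    Gaussian factor absorbs the extra |y|.\<close>
  show "integrable lborel (\<lambda>y. exp (- (y\<^sup>2) * t) * norm (k y))" if t: "t > 0"
  proof (rule Bochner_Integration.integrable_bound)
    show "integrable lborel (\<lambda>y. (1 + 1 / t) / pi * norm (F (Complex 0 y)))" using F(4) by simp
    show "AE y in lborel. norm (exp (- (y\<^sup>2) * t) * norm (k y)) \<le> norm ((1 + 1 / t) / pi * norm (F (Complex 0 y)))"
    proof (rule AE_I2)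
      fix y :: real
      have "\<bar>y\<bar> \<le> 1 + y\<^sup>2"
        using zero_le_power2[of "\<bar>y\<bar> - 1"] by (simp add: power2_eq_square algebra_simps)
      also have "\<dots> \<le> (1 + 1 / t) * (1 + y\<^sup>2 * t)"
        using t by (simp add: field_simps)
      also have "\<dots> \<le> (1 + 1 / t) * exp (y\<^sup>2 * t)"
        using t by (intro mult_left_mono exp_ge_add_one_self) auto
      finally have "exp (- (y\<^sup>2) * t) * \<bar>y\<bar> \<le> exp (- (y\<^sup>2) * t) * ((1 + 1 / t) * exp (y\<^sup>2 * t))"
        by (intro mult_left_mono) auto
      also have "\<dots> = 1 + 1 / t" by (simp add: exp_minus)
      finally have "exp (- (y\<^sup>2) * t) * \<bar>y\<bar> * (norm (F (Complex 0 y)) / pi) \<le> (1 + 1 / t) * (norm (F (Complex 0 y)) / pi)"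
        by (intro mult_right_mono) auto
      then show "norm (exp (- (y\<^sup>2) * t) * norm (k y)) \<le> norm ((1 + 1 / t) / pi * norm (F (Complex 0 y)))"
        using t by (simp add: nk abs_mult)
    qed
  qed measurable
  have bd: "\<bar>y\<bar> / (s + y\<^sup>2) \<le> 1 + 1 / s" if s: "s > 0" for s y :: real
  proof -
    have "\<bar>y\<bar> \<le> 1 + y\<^sup>2"
      using zero_le_power2[of "\<bar>y\<bar> - 1"] by (simp add: power2_eq_square algebra_simps)
    also have "\<dots> \<le> (1 + 1 / s) * (s + y\<^sup>2)"
      using s by (simp add: field_simps)
    finally show ?thesis using s by (simp add: pos_divide_le_eq add_pos_nonneg)
  qed
  show ik: "integrable lborel (\<lambda>y. norm (k y) / (s + y\<^sup>2))" if s: "s > 0" for s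
  proof (rule Bochner_Integration.integrable_bound)
    show "integrable lborel (\<lambda>y. (1 + 1 / s) * (norm (F (Complex 0 y)) / pi))" using F(4) by simp
    show "AE y in lborel. norm (norm (k y) / (s + y\<^sup>2)) \<le> norm ((1 + 1 / s) * (norm (F (Complex 0 y)) / pi))"
    proof (rule AE_I2)
      fix y :: real
      have "\<bar>y\<bar> / (s + y\<^sup>2) * (norm (F (Complex 0 y)) / pi) \<le> (1 + 1 / s) * (norm (F (Complex 0 y)) / pi)"
        using bd[OF s] by (intro mult_right_mono) auto
      then show "norm (norm (k y) / (s + y\<^sup>2)) \<le> norm ((1 + 1 / s) * (norm (F (Complex 0 y)) / pi))"
        using s by (simp add: nk abs_mult mult.commute)
    qed
  qed measurable
  show "(LBINT y. k y / (s + complex_of_real (y\<^sup>2))) = complex_of_real (1 / (1 + s powr a))" if s: "s > 0"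
  proof -
    define w0 where "w0 = sqrt s"
    have w0: "w0 > 0" "w0\<^sup>2 = s" using s by (auto simp: w0_def)
    \<comment> \<open>The extra factor is 1 at \<open>w0\<close>, has norm at most 2 on the half
      plane, so that G keeps the decay of F, and on the imaginary axis turns the denominator w0 - iy
      into (w0 + iy)(w0 - iy) = s + y^2.\<close>
    define G where "G w = F w * (2 * w / (w + complex_of_real w0))" for w
    have nz0: "w + complex_of_real w0 \<noteq> 0" if "Re w \<ge> 0" for w
    proof -
      have "Re (w + complex_of_real w0) > 0" using that w0(1) by simp
      then show ?thesis by (metis less_irrefl zero_complex.simps(1))
    qed
    have cG: "continuous_on {z. Re z \<ge> 0} G"
      unfolding G_def by (intro continuous_intros F(1)) (use nz0 in auto)
    have hG: "G holomorphic_on {z. Re z > 0}"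
      unfolding G_def by (intro holomorphic_intros F(2)) (use nz0 in auto)
    have bG: "norm (G z) \<le> 2 * norm (F z)" if z: "Re z \<ge> 0" for z
    proof -
      have "(norm z)\<^sup>2 \<le> (norm (z + complex_of_real w0))\<^sup>2"
        using z w0(1) by (simp add: cmod_power2)
      then have "norm z \<le> norm (z + complex_of_real w0)" by (simp add: power2_le_iff_abs_le)
      then have "norm (2 * z / (z + complex_of_real w0)) \<le> 2"
        using nz0[OF z] by (simp add: norm_divide norm_mult pos_divide_le_eq)
      then have "norm (F z) * norm (2 * z / (z + complex_of_real w0)) \<le> norm (F z) * 2"
        by (intro mult_left_mono) auto
      then show ?thesis unfolding G_def norm_mult[of "F z"] by (simp add: mult.commute)
    qed
    have dG: "\<exists>R. \<forall>z. Re z \<ge> 0 \<longrightarrow> norm z \<ge> R \<longrightarrow> norm (G z) \<le> e" if e: "e > 0" for e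
    proof -
      obtain R where "\<And>z. norm z \<ge> R \<Longrightarrow> norm (F z) \<le> e / 2" using F(3)[of "e / 2"] e by auto
      then show ?thesis using bG by (intro exI[of _ R]) (fastforce intro: order.trans)
    qed
    have eq: "G (Complex 0 y) / (w0 - Complex 0 y) = 2 * pi * (k y / (s + complex_of_real (y\<^sup>2)))" for y
    proof -
      have iy: "\<i> * complex_of_real y = Complex 0 y" by (simp add: complex_eq_iff)
      have sy: "s + complex_of_real (y\<^sup>2) = (Complex 0 y + complex_of_real w0) * (complex_of_real w0 - Complex 0 y)"
        using w0(2) by (simp add: complex_eq_iff power2_eq_square algebra_simps)
      have "G (Complex 0 y) / (w0 - Complex 0 y)
          = 2 * (Complex 0 y * F (Complex 0 y)) / ((Complex 0 y + complex_of_real w0) * (complex_of_real w0 - Complex 0 y))"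
        by (simp add: G_def mult_ac)
      also have "\<dots> = 2 * pi * (k y / ((Complex 0 y + complex_of_real w0) * (complex_of_real w0 - Complex 0 y)))"
        unfolding k iy by simp
      finally show ?thesis unfolding sy .
    qed
    have "integrable lborel (\<lambda>y. k y / (s + complex_of_real (y\<^sup>2)))"
    proof (rule Bochner_Integration.integrable_bound[OF ik[OF s]])
      have "norm (s + complex_of_real (y\<^sup>2)) = s + y\<^sup>2" for y
        unfolding of_real_add[symmetric] norm_of_real using s by simp
      then show "AE y in lborel. norm (k y / (s + complex_of_real (y\<^sup>2))) \<le> norm (norm (k y) / (s + y\<^sup>2))"
        using s by (simp add: norm_divide)
    qed measurable
    then have "integrable lborel (\<lambda>y. G (Complex 0 y) / (w0 - Complex 0 y))"
      unfolding eq by (rule integrable_mult_right)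
    from half_plane_Cauchy_formula[OF hG cG w0(1) dG this]
    have "2 * pi * (LBINT y. k y / (s + complex_of_real (y\<^sup>2))) = 2 * pi * G w0"
      by (simp only: eq integral_mult_right_zero)
    then have "(LBINT y. k y / (s + complex_of_real (y\<^sup>2))) = G w0"
      by (simp only: mult_cancel_left) simp
    also have "\<dots> = F w0" using w0(1) by (simp add: G_def)
    also have "\<dots> = complex_of_real (1 / (1 + w0 powr (2 * a)))"
      using w0(1) by (simp add: F_def powr_of_real flip: of_real_mult)
    also have "w0 powr (2 * a) = s powr a"
      using w0 by (metis powr_powr powr_numeral less_imp_le)
    finally show ?thesis .
  qed
qed

section \<open>Quadratic decay of the kernel for 1 < a < 2\<close>

lemma second_geometric_sums:
  fixes x :: real
  assumes x: "norm x < 1"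
  shows "(\<lambda>n. real (Suc n) * real (Suc (Suc n)) * x ^ n) sums (2 / (1 - x) ^ 3)"
proof -
  have "(\<lambda>n. diffs (\<lambda>n. real (Suc n)) n * x ^ n) sums (2 / (1 - x) ^ 3)"
  proof (rule termdiffs_sums_strong[OF _ _ x])
    show "(\<lambda>n. real (Suc n) * z ^ n) sums (1 / (1 - z)\<^sup>2)" if "norm z < 1" for z :: real
      using geometric_deriv_sums[OF that] by simp
    define y where "y = 1 - x"
    have y: "y \<noteq> 0" using x by (auto simp: y_def)
    have "((\<lambda>z. 1 / (1 - z)\<^sup>2) has_field_derivative 2 * y / (y\<^sup>2 * y\<^sup>2)) (at x)"
      using y by (auto intro!: derivative_eq_intros simp: y_def)
    also have "2 * y / (y\<^sup>2 * y\<^sup>2) = 2 / y ^ 3"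
      using y by (simp add: power2_eq_square power3_eq_cube)
    finally show "((\<lambda>z. 1 / (1 - z)\<^sup>2) has_field_derivative 2 / (1 - x) ^ 3) (at x)"
      by (simp add: y_def)
  qed
  then show ?thesis by (simp add: diffs_def)
qed

text \<open>The right-hand side is the second derivative of \<open>1 / (1 + s powr a)\<close>, written in terms of
  \<open>q = s powr (- a)\<close>.\<close>

lemma laplace_square_ml_kernel:
  fixes a s :: real
  assumes a: "a > 0" and s: "s > 1"
  shows "set_integrable lborel {0<..} (\<lambda>t. exp (- s * t) * (t\<^sup>2 * ml_kernel a t))"
    and "(LBINT t:{0<..}. exp (- s * t) * (t\<^sup>2 * ml_kernel a t))
       = s powr (- a - 2) * (2 * a\<^sup>2 / (1 + s powr (- a)) ^ 3 + (a - a\<^sup>2) / (1 + s powr (- a))\<^sup>2)"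
proof -
  define c where "c n = (- 1) ^ n / Gamma (a * real (Suc n))" for n
  define \<nu> where "\<nu> n = a * real (Suc n) + 2" for n
  define q where "q = s powr (- a)"
  \<comment> \<open>With \<mu> = a (n+1), this is \<mu> (\<mu>+1) = Gamma(\<mu>+2) / Gamma(\<mu>),
    written in terms of (n+1)(n+2) and n+1 to match the twice and once differentiated geometric
    series.\<close>
  define e where "e n = a\<^sup>2 * (real (Suc n) * real (Suc (Suc n))) + (a - a\<^sup>2) * real (Suc n)" for n
  have q: "0 < q" "q < 1" using s a by (auto simp: q_def powr_less_one)
  have \<mu>: "a * real (Suc n) > 0" for n using a by simp
  have gp: "Gamma (a * real (Suc n)) > 0" for n
    using \<mu> by (intro Gamma_real_pos)
  have G2: "Gamma (\<nu> n) = e n * Gamma (a * real (Suc n))" for n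
  proof -
    let ?\<mu> = "a * real (Suc n)"
    have "Gamma (?\<mu> + 1 + 1) = (?\<mu> + 1) * Gamma (?\<mu> + 1)"
      using \<mu>[of n] by (intro Gamma_plus1) (auto elim!: nonpos_Ints_cases)
    also have "Gamma (?\<mu> + 1) = ?\<mu> * Gamma ?\<mu>"
      using \<mu>[of n] by (intro Gamma_plus1) (auto elim!: nonpos_Ints_cases)
    also have "(?\<mu> + 1) * (?\<mu> * Gamma ?\<mu>) = e n * Gamma ?\<mu>"
      by (simp add: e_def power2_eq_square algebra_simps)
    finally show ?thesis by (simp add: \<nu>_def add.assoc)
  qed
  have e0: "e n \<ge> 0" for n
  proof -
    have "Gamma (\<nu> n) > 0" using \<mu>[of n] by (intro Gamma_real_pos) (simp add: \<nu>_def)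
    then show ?thesis using gp[of n] by (simp add: G2 zero_less_mult_iff)
  qed
  have sp: "s powr (- \<nu> n) = s powr (- a - 2) * q ^ n" for n
    using s by (simp add: q_def \<nu>_def powr_realpow[symmetric] powr_powr powr_add[symmetric] algebra_simps)
  have t2: "c n * (Gamma (\<nu> n) * s powr (- \<nu> n)) = s powr (- a - 2) * (e n * (- q) ^ n)" for n
    unfolding sp G2 using gp[of n] by (simp add: c_def power_minus[of q])
  have t1: "\<bar>c n\<bar> * (Gamma (\<nu> n) * s powr (- \<nu> n)) = s powr (- a - 2) * (e n * q ^ n)" for n
    unfolding sp G2 using gp[of n] by (simp add: c_def)
  have es: "(\<lambda>n. e n * x ^ n) sums (a\<^sup>2 * (2 / (1 - x) ^ 3) + (a - a\<^sup>2) * (1 / (1 - x)\<^sup>2))"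
    if x: "norm x < 1" for x
    using sums_add[OF sums_mult[OF second_geometric_sums[OF x], of "a\<^sup>2"]
        sums_mult[OF geometric_deriv_sums[OF x], of "a - a\<^sup>2"]]
    by (simp add: e_def algebra_simps)
  have sm: "summable (\<lambda>n. \<bar>c n\<bar> * (Gamma (\<nu> n) * s powr (- \<nu> n)))"
    unfolding t1 using q by (intro summable_mult sums_summable[OF es]) auto
  have \<nu>0: "\<nu> n > 0" for n using \<mu>[of n] by (simp add: \<nu>_def)
  have pt: "t powr (\<nu> n - 1) = t\<^sup>2 * t powr (a * real (Suc n) - 1)" if "t > 0" for n t
    using that by (simp add: \<nu>_def powr_add[symmetric] flip: powr_numeral)
  have pts: "summable (\<lambda>n. \<bar>c n\<bar> * t powr (\<nu> n - 1))" if "t > 0" for t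
    using summable_mult[OF mittag_leffler_kernel_series(1)[OF a that], of "t\<^sup>2"]
    by (simp add: pt[OF that] c_def mult.left_commute)
  note L = laplace_powr_series[of \<nu> s c, OF \<nu>0 _ pts sm]
  have f: "indicator {0<..} t *\<^sub>R (exp (- s * t) * (\<Sum>n. c n * t powr (\<nu> n - 1)))
    = indicator {0<..} t *\<^sub>R (exp (- s * t) * (t\<^sup>2 * ml_kernel a t))" for t
  proof (cases "t > 0")
    case True
    have "summable (\<lambda>n. c n * t powr (a * real (Suc n) - 1))"
      by (rule summable_norm_cancel)
         (use mittag_leffler_kernel_series(1)[OF a True] in \<open>simp add: c_def abs_mult\<close>)
    from suminf_mult[OF this, of "t\<^sup>2"] have "(\<Sum>n. c n * t powr (\<nu> n - 1)) = t\<^sup>2 * ml_kernel a t"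
      unfolding mittag_leffler_kernel_series(2)[OF a True] by (simp add: pt[OF True] c_def mult.left_commute)
    then show ?thesis by simp
  qed simp
  have "set_integrable lborel {0<..} (\<lambda>t. exp (- s * t) * (\<Sum>n. c n * t powr (\<nu> n - 1)))"
    by (rule L(1)) (use s in auto)
  then show "set_integrable lborel {0<..} (\<lambda>t. exp (- s * t) * (t\<^sup>2 * ml_kernel a t))"
    by (simp only: set_integrable_def f)
  have "(LBINT t:{0<..}. exp (- s * t) * (\<Sum>n. c n * t powr (\<nu> n - 1)))
     = (\<Sum>n. c n * (Gamma (\<nu> n) * s powr (- \<nu> n)))"
    by (rule L(2)) (use s in auto)
  also have "\<dots> = s powr (- a - 2) * (a\<^sup>2 * (2 / (1 - (- q)) ^ 3) + (a - a\<^sup>2) * (1 / (1 - (- q))\<^sup>2))"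
    unfolding t2 using q by (intro sums_unique[symmetric] sums_mult es) auto
  also have "\<dots> = s powr (- a - 2) * (2 * a\<^sup>2 / (1 + q) ^ 3 + (a - a\<^sup>2) / (1 + q)\<^sup>2)"
    by (simp add: mult.commute)
  finally show "(LBINT t:{0<..}. exp (- s * t) * (t\<^sup>2 * ml_kernel a t))
       = s powr (- a - 2) * (2 * a\<^sup>2 / (1 + s powr (- a)) ^ 3 + (a - a\<^sup>2) / (1 + s powr (- a))\<^sup>2)"
    unfolding q_def by (simp only: set_lebesgue_integral_def f)
qed

text \<open>Shifting the Bromwich line to \<open>Re z = 1 / t\<close>: since \<open>a > 1\<close> the second derivative of
  \<open>1 / (1 + z powr a)\<close> is integrable along vertical lines uniformly up to the imaginary axis.\<close>

lemma ml_kernel_bound: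
  fixes a :: real
  assumes a: "1 < a" "a < 2"
  obtains C where "\<And>t. t > 0 \<Longrightarrow> \<bar>t\<^sup>2 * ml_kernel a t\<bar> \<le> C"
proof -
  obtain c where c: "c > 0"
    "\<And>z. Re z \<ge> 0 \<Longrightarrow> c * (1 + norm z powr a) \<le> norm (1 + z powr complex_of_real a)"
    by (rule norm_one_plus_powr_ge[of a]) (use a in auto)
  define Q where "Q z = z powr complex_of_real (- a)" for z
  define G where "G z = z powr complex_of_real (- a - 2) * (complex_of_real (2 * a\<^sup>2) / (1 + Q z) ^ 3
      + complex_of_real (a - a\<^sup>2) / (1 + Q z)\<^sup>2)" for z
  define K where "K = 2 * a\<^sup>2 / c ^ 3 + (a\<^sup>2 - a) / c\<^sup>2"
  have aa: "a\<^sup>2 - a \<ge> 0" using a by (simp add: power2_eq_square)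
  have K: "K \<ge> 0" unfolding K_def using c(1) aa by (intro add_nonneg_nonneg divide_nonneg_nonneg) auto
  have Q: "c * (1 + norm z powr (- a)) \<le> norm (1 + Q z)" if z: "Re z \<ge> 0" "z \<noteq> 0" for z
  proof -
    have "z powr complex_of_real a \<noteq> 0" using z by simp
    then have "1 + Q z = (1 + z powr complex_of_real a) / z powr complex_of_real a"
      using z by (simp add: Q_def powr_minus field_simps)
    then have "norm (1 + Q z) = norm (1 + z powr complex_of_real a) / norm z powr a"
      by (simp add: norm_divide norm_powr_of_real)
    also have "\<dots> \<ge> c * (1 + norm z powr a) / norm z powr a"
      using c(2)[OF z(1)] by (intro divide_right_mono) auto
    also have "c * (1 + norm z powr a) / norm z powr a = c * (1 + norm z powr (- a))"
      using z(2) by (simp add: powr_minus field_simps)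
    finally show ?thesis .
  qed
  have Qnz: "1 + Q z \<noteq> 0" if z: "Re z \<ge> 0" "z \<noteq> 0" for z
  proof -
    have "c * (1 + norm z powr (- a)) > 0" using c(1) by (intro mult_pos_pos add_pos_nonneg) auto
    then show ?thesis using Q[OF z] by auto
  qed
  \<comment> \<open>With X = |z|^(-a) the bound is K |z|^(-2) X / (1+X)^2. Estimating the last
    fraction by 1 gives the decay at infinity, by 1/X the integrable singularity at 0.\<close>
  have Gb: "norm (G z) \<le> K * min (norm z powr (a - 2)) (norm z powr (- 2))" if z: "Re z \<ge> 0" "z \<noteq> 0" for z
  proof -
    define X where "X = norm z powr (- a)"
    have X: "X > 0" using z(2) by (simp add: X_def)
    define N where "N = norm (1 + Q z)"
    have N: "N \<ge> c * (1 + X)" "c * (1 + X) > 0"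
      using Q[OF z] c(1) X by (simp_all only: N_def X_def mult_pos_pos add_pos_pos zero_less_one)
    have "norm (complex_of_real (2 * a\<^sup>2) / (1 + Q z) ^ 3 + complex_of_real (a - a\<^sup>2) / (1 + Q z)\<^sup>2)
        \<le> 2 * a\<^sup>2 / N ^ 3 + (a\<^sup>2 - a) / N\<^sup>2"
      by (rule order.trans[OF norm_triangle_ineq]) (use aa in \<open>simp add: norm_divide norm_power N_def del: of_real_diff of_real_mult\<close>)
    \<comment> \<open>One factor 1 + X \<ge> 1 of the cube is dropped to obtain a common
      denominator.\<close>
    also have "\<dots> \<le> 2 * a\<^sup>2 / (c ^ 3 * (1 + X)\<^sup>2) + (a\<^sup>2 - a) / (c\<^sup>2 * (1 + X)\<^sup>2)"
    proof (intro add_mono divide_left_mono mult_pos_pos)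
      have "c ^ 3 * (1 + X)\<^sup>2 \<le> c ^ 3 * (1 + X) ^ 3"
        using c(1) X by (intro mult_left_mono power_increasing) auto
      also have "\<dots> = (c * (1 + X)) ^ 3" by (simp add: power_mult_distrib)
      also have "\<dots> \<le> N ^ 3" using N by (intro power_mono) auto
      finally show "c ^ 3 * (1 + X)\<^sup>2 \<le> N ^ 3" .
      have "(c * (1 + X))\<^sup>2 \<le> N\<^sup>2" using N by (intro power_mono) auto
      then show "c\<^sup>2 * (1 + X)\<^sup>2 \<le> N\<^sup>2" by (simp add: power_mult_distrib)
    qed (use less_le_trans[OF N(2,1)] X c(1) aa in auto)
    also have "\<dots> = K / (1 + X)\<^sup>2" by (simp add: K_def add_divide_distrib)
    finally have "norm (G z) \<le> norm z powr (- a - 2) * (K / (1 + X)\<^sup>2)"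
      unfolding G_def norm_mult norm_powr_of_real by (intro mult_left_mono) auto
    also have "norm z powr (- a - 2) = norm z powr (- 2) * X"
      unfolding X_def powr_add[symmetric] by (simp add: algebra_simps)
    finally have main: "norm (G z) \<le> K * (norm z powr (- 2) * (X / (1 + X)\<^sup>2))"
      by (simp add: mult_ac)
    have x1: "X / (1 + X)\<^sup>2 \<le> 1"
      using X by (simp add: divide_le_eq power2_eq_square algebra_simps)
    have "X / (1 + X)\<^sup>2 \<le> X / X\<^sup>2"
      using X by (intro divide_left_mono power_mono mult_pos_pos) auto
    then have x2: "X / (1 + X)\<^sup>2 \<le> 1 / X" using X by (simp add: power2_eq_square)
    have "norm z powr (- 2) * (X / (1 + X)\<^sup>2) \<le> norm z powr (- 2) * 1"
      using x1 by (intro mult_left_mono) auto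
    moreover have "norm z powr (- 2) * (X / (1 + X)\<^sup>2) \<le> norm z powr (- 2) * (1 / X)"
      using x2 by (intro mult_left_mono) auto
    moreover have "norm z powr (- 2) * (1 / X) = norm z powr (a - 2)"
    proof -
      have "1 / X = norm z powr a" by (simp add: X_def powr_minus divide_inverse)
      then show ?thesis by (simp only: powr_add[symmetric]) (simp add: algebra_simps)
    qed
    ultimately show ?thesis
      by (intro order.trans[OF main] mult_left_mono K) auto
  qed
  define W where "W = (LBINT y::real. min (\<bar>y\<bar> powr (a - 2)) (\<bar>y\<bar> powr (- 2)))"
  have iW: "integrable lborel (\<lambda>y::real. min (\<bar>y\<bar> powr (a - 2)) (\<bar>y\<bar> powr (- 2)))"
    by (rule integrable_min_powr) (use a in simp)
  have a0: "a > 0" using a by simp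
  show thesis
  proof (rule that)
    fix t :: real assume t: "t > 0"
    \<comment> \<open>On this line exp(\<sigma> t) = e, and the majorant of |G| involves only y, so
      the final constant does not depend on t.\<close>
    define \<sigma> where "\<sigma> = 1 / t"
    have \<sigma>: "\<sigma> > 0" "\<sigma> * t = 1" using t by (auto simp: \<sigma>_def)
    have slit: "z \<notin> \<real>\<^sub>\<le>\<^sub>0" "z \<noteq> 0" if "Re z \<ge> \<sigma>" for z
      using that \<sigma> by (auto simp: complex_nonpos_Reals_iff)
    have hol': "G holomorphic_on {z. Re z \<ge> \<sigma>}"
      unfolding G_def Q_def
    proof (intro holomorphic_intros)
      show "(1 + z powr complex_of_real (- a)) ^ 3 \<noteq> 0" "(1 + z powr complex_of_real (- a))\<^sup>2 \<noteq> 0"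
        if "z \<in> {z. Re z \<ge> \<sigma>}" for z
        using Qnz[of z] that \<sigma> slit[of z] unfolding Q_def by auto
    qed (use slit in auto)
    have hol: "G holomorphic_on {z. Re z > \<sigma>}"
      by (rule holomorphic_on_subset[OF hol']) auto
    have cont: "continuous_on {z. Re z \<ge> \<sigma>} G" by (rule holomorphic_on_imp_continuous_on[OF hol'])
    have decay: "\<exists>R. \<forall>z. Re z \<ge> \<sigma> \<longrightarrow> norm z \<ge> R \<longrightarrow> norm (G z) \<le> e" if e: "e > 0" for e
    proof (intro exI allI impI)
      fix z assume z: "Re z \<ge> \<sigma>" "norm z \<ge> K / e + 1"
      have n1: "norm z \<ge> 1" "norm z \<ge> K / e"
        using z(2) K e by (smt (verit) divide_nonneg_pos)+
      have "norm (G z) \<le> K * min (norm z powr (a - 2)) (norm z powr (- 2))"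
        using z \<sigma> slit[OF z(1)] by (intro Gb) auto
      also have "\<dots> \<le> K * norm z powr (- 2)"
        by (intro mult_left_mono K) simp
      also have "\<dots> \<le> K * norm z powr (- 1)"
        using n1 K by (intro mult_left_mono powr_mono) auto
      also have "\<dots> = K / norm z" using n1 by (simp add: powr_minus divide_inverse)
      also have "\<dots> \<le> e" using n1 e by (simp add: divide_le_eq mult.commute)
      finally show "norm (G z) \<le> e" .
    qed
    have line: "norm (G (Complex \<sigma> y)) \<le> K * min (\<bar>y\<bar> powr (a - 2)) (\<bar>y\<bar> powr (- 2))" if "y \<noteq> 0" for y
    proof -
      have y: "0 < \<bar>y\<bar>" "\<bar>y\<bar> \<le> norm (Complex \<sigma> y)" using that abs_Im_le_cmod[of "Complex \<sigma> y"] by auto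
      have "norm (G (Complex \<sigma> y)) \<le> K * min (norm (Complex \<sigma> y) powr (a - 2)) (norm (Complex \<sigma> y) powr (- 2))"
        using \<sigma> that by (intro Gb) (auto simp: complex_eq_iff)
      also have "\<dots> \<le> K * min (\<bar>y\<bar> powr (a - 2)) (\<bar>y\<bar> powr (- 2))"
        using y a by (intro mult_left_mono K min.mono powr_mono2') auto
      finally show ?thesis .
    qed
    \<comment> \<open>The point y = 0 has to be excluded: there the right-hand side is 0, because
      \<open>0 powr x = 0\<close>.\<close>
    have ae: "AE y in lborel. norm (G (Complex \<sigma> y)) \<le> K * min (\<bar>y\<bar> powr (a - 2)) (\<bar>y\<bar> powr (- 2))"
      using AE_lborel_singleton[of "0::real"] by eventually_elim (rule line)
    have int: "integrable lborel (\<lambda>y. G (Complex \<sigma> y))"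
    proof (rule Bochner_Integration.integrable_bound[OF integrable_mult_right[OF iW, of K]])
      have "continuous_on UNIV (\<lambda>y. G (Complex \<sigma> y))"
        by (rule continuous_on_compose2[OF cont]) (auto intro!: continuous_intros simp: Complex_eq)
      then show "(\<lambda>y. G (Complex \<sigma> y)) \<in> borel_measurable lborel"
        by (simp add: borel_measurable_continuous_onI)
      show "AE y in lborel. norm (G (Complex \<sigma> y)) \<le> norm (K * min (\<bar>y\<bar> powr (a - 2)) (\<bar>y\<bar> powr (- 2)))"
        using ae by eventually_elim (use K in \<open>auto simp: abs_mult\<close>)
    qed
    have GL: "G (complex_of_real s) = complex_of_real
       (s powr (- a - 2) * (2 * a\<^sup>2 / (1 + s powr (- a)) ^ 3 + (a - a\<^sup>2) / (1 + s powr (- a))\<^sup>2))"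
      if "s > \<sigma>" for s
    proof -
      have p: "complex_of_real s powr complex_of_real b = complex_of_real (s powr b)" for b
        using that \<sigma> by (intro powr_of_real) auto
      show ?thesis unfolding G_def Q_def p by simp
    qed
    have ch: "continuous_on {0<..} (\<lambda>t. t\<^sup>2 * ml_kernel a t)"
      by (intro continuous_on_mult continuous_on_mittag_leffler_kernel[OF a0] continuous_intros)
    have "\<bar>t\<^sup>2 * ml_kernel a t\<bar> \<le> exp (\<sigma> * t) / (2 * pi) * (LBINT y. norm (G (Complex \<sigma> y)))"
      by (rule Bromwich_representation(1)[OF ch laplace_square_ml_kernel[OF a0] cont hol decay int GL t])
    also have "\<dots> \<le> exp 1 / (2 * pi) * (LBINT y. K * min (\<bar>y\<bar> powr (a - 2)) (\<bar>y\<bar> powr (- 2)))"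
      unfolding \<sigma>(2) using ae int iW by (intro mult_left_mono integral_mono_AE) auto
    finally show "\<bar>t\<^sup>2 * ml_kernel a t\<bar> \<le> exp 1 / (2 * pi) * (K * W)"
      by (simp add: W_def)
  qed
qed

section \<open>The Laplace transform on the whole range\<close>

text \<open>Dominated convergence along s = 1/(n+1), with |f| as majorant.\<close>

lemma laplace_at_zero:
  fixes f L :: "real \<Rightarrow> real"
  assumes f: "set_integrable lborel {0<..} f"
    and L: "\<And>s. s > 0 \<Longrightarrow> (LBINT t:{0<..}. exp (- s * t) * f t) = L s"
    and lim: "(\<lambda>n. L (1 / real (Suc n))) \<longlonglongrightarrow> l"
  shows "(LBINT t:{0<..}. f t) = l"
proof -
  let ?u = "\<lambda>n t. indicator {0<..} t *\<^sub>R (exp (- (1 / real (Suc n)) * t) * f t)"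
  have i: "integrable lborel (\<lambda>t. indicator {0<..} t *\<^sub>R f t)"
    using f by (simp add: set_integrable_def)
  have [measurable]: "(\<lambda>t. indicator {0<..} t *\<^sub>R f t) \<in> borel_measurable borel" using i by auto
  have "(\<lambda>n. LBINT t. ?u n t) \<longlonglongrightarrow> (LBINT t. indicator {0<..} t *\<^sub>R f t)"
  proof (rule integral_dominated_convergence[OF _ _ integrable_norm[OF i]])
    show "?u n \<in> borel_measurable lborel" for n
    proof -
      have "?u n = (\<lambda>t. exp (- (1 / real (Suc n)) * t) * (indicator {0<..} t *\<^sub>R f t))"
        by (auto simp: fun_eq_iff)
      also have "\<dots> \<in> borel_measurable lborel" by measurable
      finally show ?thesis .
    qed
    show "AE t in lborel. norm (?u n t) \<le> norm (indicator {0<..} t *\<^sub>R f t)" for n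
      by (rule AE_I2) (auto simp: indicator_def abs_mult intro!: mult_left_le_one_le)
    show "AE t in lborel. (\<lambda>n. ?u n t) \<longlonglongrightarrow> indicator {0<..} t *\<^sub>R f t"
    proof (rule AE_I2)
      fix t :: real
      have "(\<lambda>n. ?u n t) \<longlonglongrightarrow> indicator {0<..} t *\<^sub>R (exp (- 0 * t) * f t)"
        by (intro tendsto_intros LIMSEQ_Suc lim_1_over_n)
      then show "(\<lambda>n. ?u n t) \<longlonglongrightarrow> indicator {0<..} t *\<^sub>R f t" by simp
    qed
  qed measurable
  moreover have "(LBINT t. ?u n t) = L (1 / real (Suc n))" for n
    using L[of "1 / real (Suc n)"] by (simp only: set_lebesgue_integral_def) simp
  ultimately have "(\<lambda>n. L (1 / real (Suc n))) \<longlonglongrightarrow> (LBINT t:{0<..}. f t)"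
    by (simp only: set_lebesgue_integral_def)
  from LIMSEQ_unique[OF this lim] show ?thesis .
qed

text \<open>Here the sign of f replaces the majorant: exp(-t/(n+1)) f(t) increases to f(t), and its
  integrals converge.\<close>

lemma set_integrable_of_laplace_nonneg:
  fixes f L :: "real \<Rightarrow> real"
  assumes nn: "\<And>t. t > 0 \<Longrightarrow> f t \<ge> 0" and [measurable]: "set_borel_measurable borel {0<..} f"
    and int: "\<And>s. s > 0 \<Longrightarrow> set_integrable lborel {0<..} (\<lambda>t. exp (- s * t) * f t)"
    and L: "\<And>s. s > 0 \<Longrightarrow> (LBINT t:{0<..}. exp (- s * t) * f t) = L s"
    and lim: "(\<lambda>n. L (1 / real (Suc n))) \<longlonglongrightarrow> l"
  shows "set_integrable lborel {0<..} f"
  unfolding set_integrable_def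
proof (rule integrable_monotone_convergence)
  let ?u = "\<lambda>n t. indicator {0<..} t *\<^sub>R (exp (- (1 / real (Suc n)) * t) * f t)"
  show "integrable lborel (?u n)" for n
    using int[of "1 / real (Suc n)"] by (simp only: set_integrable_def) simp
  show "AE t in lborel. mono (\<lambda>n. ?u n t)"
  proof (intro AE_I2 monoI)
    fix t :: real and m n :: nat assume "m \<le> n"
    then have "1 / real (Suc n) \<le> 1 / real (Suc m)" by (simp add: frac_le)
    then have "exp (- (1 / real (Suc m)) * t) * f t \<le> exp (- (1 / real (Suc n)) * t) * f t" if "t > 0"
      using that nn[OF that] by (intro mult_right_mono iffD2[OF exp_le_cancel_iff]) auto
    then show "?u m t \<le> ?u n t"
      by (cases "t > 0") simp_all
  qed
  show "AE t in lborel. (\<lambda>n. ?u n t) \<longlonglongrightarrow> indicator {0<..} t *\<^sub>R f t"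
  proof (rule AE_I2)
    fix t :: real
    have "(\<lambda>n. ?u n t) \<longlonglongrightarrow> indicator {0<..} t *\<^sub>R (exp (- 0 * t) * f t)"
      by (intro tendsto_intros LIMSEQ_Suc lim_1_over_n)
    then show "(\<lambda>n. ?u n t) \<longlonglongrightarrow> indicator {0<..} t *\<^sub>R f t" by simp
  qed
  have "(LBINT t. ?u n t) = L (1 / real (Suc n))" for n
    using L[of "1 / real (Suc n)"] by (simp only: set_lebesgue_integral_def) simp
  then show "(\<lambda>n. LBINT t. ?u n t) \<longlonglongrightarrow> l" using lim by simp
  show "(\<lambda>t. indicator {0<..} t *\<^sub>R f t) \<in> borel_measurable lborel"
    using assms(2) by (simp add: set_borel_measurable_def)
qed

text \<open>The exponents \<open>- (y\<^sup>2)\<close> are real, so the real part of the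
  representation is a mixture with the nonnegative weight \<open>Re (k y)\<close>.\<close>

lemma ml_kernel_lt_1:
  fixes a :: real
  assumes a: "1/2 < a" "a < 1"
  shows "completely_monotone (ml_kernel a)"
    and "s > 0 \<Longrightarrow> set_integrable lborel {0<..} (\<lambda>t. exp (- s * t) * ml_kernel a t)"
    and "s > 0 \<Longrightarrow> (LBINT t:{0<..}. exp (- s * t) * ml_kernel a t) = 1 / (1 + s powr a)"
proof -
  have a0: "a > 0" using a by simp
  define k where "k y = \<i> * complex_of_real y / (pi * (1 + Complex 0 y powr complex_of_real (2 * a)))" for y
  note S = inverse_one_plus_powr_Stieltjes[OF a, folded k_def]
  define p where "p y = complex_of_real (- (y\<^sup>2))" for y :: real
  have [measurable]: "k \<in> borel_measurable borel" by (rule S(1))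
  have mp: "p \<in> borel_measurable borel" unfolding p_def by measurable
  have ps: "Re (p y) \<le> 0" for y by (simp add: p_def)
  have 1: "integrable lborel (\<lambda>y. exp (Re (p y) * t) * norm (k y))" if "t > 0" for t
    using S(3)[OF that] by (simp add: p_def)
  have 2: "integrable lborel (\<lambda>y. norm (k y) / (s - Re (p y)))" if "s > 0" for s
    using S(4)[OF that] by (simp add: p_def)
  have 3: "(LBINT y. k y / (s - p y)) = complex_of_real (1 / (1 + s powr a))" if "s > 0" for s
    using S(5)[OF that] by (simp add: p_def)
  note R = laplace_mixture_representation[OF continuous_on_mittag_leffler_kernel[OF a0]
      laplace_mittag_leffler_kernel[OF a0] mp S(1) ps 1 2 3]
  show "s > 0 \<Longrightarrow> set_integrable lborel {0<..} (\<lambda>t. exp (- s * t) * ml_kernel a t)"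
    and "s > 0 \<Longrightarrow> (LBINT t:{0<..}. exp (- s * t) * ml_kernel a t) = 1 / (1 + s powr a)"
    by (rule R(2); simp) (rule R(3); simp)
  have e: "exp (p y * complex_of_real t) = complex_of_real (exp (- (y\<^sup>2) * t))" for y t
    by (simp add: p_def exp_of_real[symmetric])
  have i: "integrable lborel (\<lambda>y. complex_of_real (exp (- (y\<^sup>2) * t)) * k y)" if "t > 0" for t
    by (rule Bochner_Integration.integrable_bound[OF S(3)[OF that]]) (auto simp: norm_mult)
  have re: "Re (complex_of_real (exp (- (y\<^sup>2) * t)) * k y) = exp (- (y\<^sup>2) * t) * Re (k y)" for y t
    by simp
  show "completely_monotone (ml_kernel a)"
  proof (rule completely_monotone_exp_mixture[where q = "\<lambda>y. y\<^sup>2" and k = "\<lambda>y. Re (k y)"])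
    fix t :: real assume t: "t > 0"
    show "integrable lborel (\<lambda>y. exp (- (y\<^sup>2) * t) * Re (k y))"
      using integrable_Re[OF i[OF t]] by (simp only: re)
    have "ml_kernel a t = Re (LBINT y. complex_of_real (exp (- (y\<^sup>2) * t)) * k y)"
      unfolding e[symmetric] by (rule R(1); simp add: t)
    also have "\<dots> = (LBINT y. exp (- (y\<^sup>2) * t) * Re (k y))"
      unfolding integral_Re[OF i[OF t], symmetric] re ..
    finally show "ml_kernel a t = (LBINT y. exp (- (y\<^sup>2) * t) * Re (k y))" .
  qed (use S(2) in auto)
qed

text \<open>Neither contour serves a = 1: 1 + w^2 vanishes at \<plusminus>i on the imaginary axis,
  and 1/(1 + z) is not absolutely integrable on vertical lines.\<close>

lemma ml_kernel_1:
  fixes t :: real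
  assumes "t > 0"
  shows "ml_kernel 1 t = exp (- t)"
proof -
  have "(- t) ^ n /\<^sub>R Gamma (1 + 1 * real n) = inverse (fact n) * (- t) ^ n" for n
    by (simp add: Gamma_fact)
  then show ?thesis
    using assms by (simp add: mittag_leffler_def exp_def divide_inverse scaleR_conv_of_real)
qed

lemma set_integrable_ml_kernel:
  fixes a :: real
  assumes a: "1 < a" "a < 2"
  shows "set_integrable lborel {0<..} (ml_kernel a)"
proof -
  have a0: "a > 0" using a by simp
  obtain C where C: "\<And>t. t > 0 \<Longrightarrow> \<bar>t\<^sup>2 * ml_kernel a t\<bar> \<le> C"
    using ml_kernel_bound[OF a] by blast
  have m: "set_borel_measurable borel {0<..} (ml_kernel a)"
    unfolding set_borel_measurable_def
    by (rule borel_measurable_continuous_on_indicator) (auto intro: continuous_on_mittag_leffler_kernel[OF a0])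
  \<comment> \<open>On (0, 1) the factor exp(-2t) is at least exp(-2), so convergence at s = 2
    handles the neighbourhood of 0; the quadratic bound handles [1, \<infinity>).\<close>
  have i1: "integrable lborel (\<lambda>t. indicator {0<..} t *\<^sub>R (exp (- 2 * t) * ml_kernel a t))"
    using laplace_mittag_leffler_kernel(1)[OF a0, of 2] by (simp add: set_integrable_def)
  have mt: "set_borel_measurable borel {1..} (\<lambda>t::real. t powr (- 2))"
    unfolding set_borel_measurable_def by measurable
  have "((\<lambda>t::real. t powr (- 2)) has_integral - (1 powr (- 2 + 1)) / (- 2 + 1)) {1..}"
    by (rule has_integral_powr_to_inf) auto
  from nonneg_has_integral_imp_LBINT(1)[OF this _ mt]
  have i2: "integrable lborel (\<lambda>t::real. indicator {1..} t *\<^sub>R t powr (- 2))"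
    by (simp add: set_integrable_def)
  show ?thesis
    unfolding set_integrable_def
  proof (rule Bochner_Integration.integrable_bound)
    show "integrable lborel (\<lambda>t. exp 2 * \<bar>indicator {0<..} t *\<^sub>R (exp (- 2 * t) * ml_kernel a t)\<bar>
        + C * (indicator {1..} t *\<^sub>R t powr (- 2)))"
      by (intro Bochner_Integration.integrable_add integrable_mult_right integrable_abs i1 i2)
    show "(\<lambda>t. indicator {0<..} t *\<^sub>R ml_kernel a t) \<in> borel_measurable lborel"
      using m by (simp add: set_borel_measurable_def)
    show "AE t in lborel. norm (indicator {0<..} t *\<^sub>R ml_kernel a t)
       \<le> norm (exp 2 * \<bar>indicator {0<..} t *\<^sub>R (exp (- 2 * t) * ml_kernel a t)\<bar>
        + C * (indicator {1..} t *\<^sub>R t powr (- 2)))"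
    proof (rule AE_I2)
      fix t :: real
      define f where "f = ml_kernel a t"
      have C0: "C \<ge> 0" using C[of 1] by simp
      consider "t \<le> 0" | "0 < t" "t < 1" | "t \<ge> 1" by linarith
      then have "\<bar>indicator {0<..} t *\<^sub>R f\<bar>
         \<le> exp 2 * \<bar>indicator {0<..} t *\<^sub>R (exp (- 2 * t) * f)\<bar> + C * (indicator {1..} t *\<^sub>R t powr (- 2))"
      proof cases
        case 2
        have "1 * \<bar>f\<bar> \<le> exp (2 - 2 * t) * \<bar>f\<bar>" using 2 by (intro mult_right_mono) auto
        then show ?thesis using 2 by (simp add: abs_mult exp_diff exp_minus divide_inverse mult_ac)
      next
        case 3
        have "\<bar>f\<bar> = t powr (- 2) * \<bar>t\<^sup>2 * f\<bar>"
          using 3 by (simp add: abs_mult powr_minus powr_numeral field_simps)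
        also have "\<dots> \<le> t powr (- 2) * C" using C[of t] 3 by (intro mult_left_mono) (auto simp: f_def)
        finally have "\<bar>f\<bar> \<le> C * t powr (- 2)" by (simp add: mult.commute)
        moreover have "0 \<le> exp 2 * \<bar>indicator {0<..} t *\<^sub>R (exp (- 2 * t) * f)\<bar>" by simp
        ultimately have "\<bar>f\<bar> \<le> exp 2 * \<bar>indicator {0<..} t *\<^sub>R (exp (- 2 * t) * f)\<bar> + C * t powr (- 2)"
          by linarith
        then show ?thesis using 3 by simp
      qed (use C0 in simp)
      then show "norm (indicator {0<..} t *\<^sub>R ml_kernel a t)
       \<le> norm (exp 2 * \<bar>indicator {0<..} t *\<^sub>R (exp (- 2 * t) * ml_kernel a t)\<bar>
        + C * (indicator {1..} t *\<^sub>R t powr (- 2)))"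
        unfolding f_def[symmetric] real_norm_def by (rule order.trans[OF _ abs_ge_self])
    qed
  qed
qed

lemma completely_monotone_ml_kernel:
  fixes a :: real
  assumes a: "1/2 < a" "a \<le> 1"
  shows "completely_monotone (ml_kernel a)"
proof (cases "a = 1")
  case True
  then show ?thesis
    using completely_monotone_cong[OF ml_kernel_1 completely_monotone_exp] by simp
next
  case False
  then show ?thesis using ml_kernel_lt_1(1) a by simp
qed

text \<open>For 1 < a < 2 the cosine is negative, so every s > 0 is admissible. For a \<ge> 2 it is
  nonnegative and forces s > 0, so s = 0 occurs only with a < 2, where the kernel is
  integrable.\<close>

lemma laplace_ml_kernel:
  fixes a s :: real
  assumes a: "1/2 < a" and s: "s \<ge> 0" "a < 2 \<or> cos (pi / a) < s"
  shows "set_integrable lborel {0<..} (\<lambda>t. exp (- s * t) * ml_kernel a t)"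
    and "(LBINT t:{0<..}. exp (- s * t) * ml_kernel a t) = 1 / (1 + s powr a)"
proof -
  have pos: "set_integrable lborel {0<..} (\<lambda>t. exp (- s * t) * ml_kernel a t)"
    "(LBINT t:{0<..}. exp (- s * t) * ml_kernel a t) = 1 / (1 + s powr a)"
    if s: "s > 0" "a < 2 \<or> cos (pi / a) < s" for s
  proof -
    consider "a < 1" | "a = 1" | "1 < a" by linarith
    then have "set_integrable lborel {0<..} (\<lambda>t. exp (- s * t) * ml_kernel a t) \<and>
      (LBINT t:{0<..}. exp (- s * t) * ml_kernel a t) = 1 / (1 + s powr a)"
    proof cases
      case 1
      then show ?thesis using ml_kernel_lt_1(2,3)[OF a _ s(1)] by simp
    next
      case 2
      have e: "indicator {0<..} t *\<^sub>R (exp (- s * t) * ml_kernel 1 t) = indicator {0<..} t *\<^sub>R exp (- (s + 1) * t)" for t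
        using ml_kernel_1[of t] by (cases "t > 0") (simp_all add: exp_add[symmetric] algebra_simps)
      have "s + 1 > 0" using s by simp
      from laplace_exp_real[OF this] show ?thesis
        unfolding 2 set_integrable_def set_lebesgue_integral_def e using s by (simp add: add.commute)
    next
      case 3
      have "cos (pi / a) < s"
      proof (cases "a < 2")
        case True
        have "cos (pi / a) \<le> cos (pi / 2)"
          using True 3 by (intro cos_monotone_0_pi_le) (auto simp: field_simps)
        then show ?thesis using s by simp
      qed (use s in auto)
      then show ?thesis using ml_kernel_laplace_gt_1[OF 3 s(1)] by simp
    qed
    then show "set_integrable lborel {0<..} (\<lambda>t. exp (- s * t) * ml_kernel a t)"
      "(LBINT t:{0<..}. exp (- s * t) * ml_kernel a t) = 1 / (1 + s powr a)" by auto
  qed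
  \<comment> \<open>The value 1 is \<open>1 / (1 + s powr a)\<close> at s = 0, since
    \<open>0 powr a = 0\<close>.\<close>
  have zero: "set_integrable lborel {0<..} (ml_kernel a)" "(LBINT t:{0<..}. ml_kernel a t) = 1" if a2: "a < 2"
  proof -
    have a0: "a > 0" using a by simp
    have "(\<lambda>n. (1 / real (Suc n)) powr a) \<longlonglongrightarrow> 0"
      by (rule tendsto_zero_powrI[OF LIMSEQ_Suc[OF lim_1_over_n] tendsto_const _ a0])
         (auto intro: always_eventually)
    then have "(\<lambda>n. 1 / (1 + (1 / real (Suc n)) powr a)) \<longlonglongrightarrow> 1 / (1 + 0)"
      by (intro tendsto_intros) auto
    then have lim: "(\<lambda>n. 1 / (1 + (1 / real (Suc n)) powr a)) \<longlonglongrightarrow> 1" by simp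
    have m: "set_borel_measurable borel {0<..} (ml_kernel a)"
      unfolding set_borel_measurable_def
      by (rule borel_measurable_continuous_on_indicator) (auto intro: continuous_on_mittag_leffler_kernel[OF a0])
    show int: "set_integrable lborel {0<..} (ml_kernel a)"
    proof (cases "a \<le> 1")
      case True
      have nn: "0 \<le> ml_kernel a t" if "t > 0" for t
        using completely_monotone_ml_kernel[OF a True] that by (simp only: completely_monotone_def)
      show ?thesis
        using set_integrable_of_laplace_nonneg[OF nn m pos lim] a2 by blast
    next
      case False
      then show ?thesis using a2 by (intro set_integrable_ml_kernel) auto
    qed
    show "(LBINT t:{0<..}. ml_kernel a t) = 1"
      using laplace_at_zero[OF int pos(2) lim] a2 by blast
  qed
  show "set_integrable lborel {0<..} (\<lambda>t. exp (- s * t) * ml_kernel a t)"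
    "(LBINT t:{0<..}. exp (- s * t) * ml_kernel a t) = 1 / (1 + s powr a)"
  proof -
    have "a < 2" if "s = 0"
    proof (rule ccontr)
      assume "\<not> a < 2"
      then have "pi / a \<le> pi / 2" by (intro divide_left_mono) auto
      moreover have "0 \<le> pi / a" using a by simp
      ultimately have "0 \<le> cos (pi / a)" by (intro cos_ge_zero) auto
      then show False using s that \<open>\<not> a < 2\<close> by simp
    qed
    then show "set_integrable lborel {0<..} (\<lambda>t. exp (- s * t) * ml_kernel a t)"
      "(LBINT t:{0<..}. exp (- s * t) * ml_kernel a t) = 1 / (1 + s powr a)"
      using pos[OF _ s(2)] zero s(1) by (cases "s = 0"; simp)+
  qed
qed

theorem lemma2p4:
  fixes \<alpha> :: real
  assumes "\<alpha> > 1"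
  shows "(\<forall>x::real. \<alpha> < 4 \<or> cos (2 * pi / \<alpha>) < x\<^sup>2 \<longrightarrow>
            set_integrable lborel {0<..}
              (\<lambda>t. exp (- (x\<^sup>2) * t) * (t powr (\<alpha>/2 - 1) * mittag_leffler (\<alpha>/2) (\<alpha>/2) (- (t powr (\<alpha>/2)))))
          \<and> cauchy_density \<alpha> x = sin (pi / \<alpha>) / (2 * pi / \<alpha>) *
              (LBINT t:{0<..}. exp (- (x\<^sup>2) * t) *
                 (t powr (\<alpha>/2 - 1) * mittag_leffler (\<alpha>/2) (\<alpha>/2) (- (t powr (\<alpha>/2))))))
       \<and> (\<alpha> \<le> 2 \<longrightarrow>
            completely_monotone (\<lambda>t. t powr (\<alpha>/2 - 1) * mittag_leffler (\<alpha>/2) (\<alpha>/2) (- (t powr (\<alpha>/2)))))"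
proof (intro conjI allI impI)
  have a: "1/2 < \<alpha>/2" using assms by simp
  {
    fix x :: real
    assume "\<alpha> < 4 \<or> cos (2 * pi / \<alpha>) < x\<^sup>2"
    then have s: "\<alpha>/2 < 2 \<or> cos (pi / (\<alpha>/2)) < x\<^sup>2" by (simp add: mult.commute)
    note L = laplace_ml_kernel[OF a zero_le_power2 s]
    show "set_integrable lborel {0<..}
        (\<lambda>t. exp (- (x\<^sup>2) * t) * (t powr (\<alpha>/2 - 1) * mittag_leffler (\<alpha>/2) (\<alpha>/2) (- (t powr (\<alpha>/2)))))"
      by (rule L(1))
    \<comment> \<open>x may be negative, so the power is taken through
      \<open>\<bar>x\<bar>\<close>.\<close>
    have "(x\<^sup>2) powr (\<alpha>/2) = (\<bar>x\<bar> powr 2) powr (\<alpha>/2)" by (simp add: powr_numeral)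
    also have "\<dots> = \<bar>x\<bar> powr \<alpha>" by (simp only: powr_powr) simp
    finally show "cauchy_density \<alpha> x = sin (pi / \<alpha>) / (2 * pi / \<alpha>) *
        (LBINT t:{0<..}. exp (- (x\<^sup>2) * t) *
           (t powr (\<alpha>/2 - 1) * mittag_leffler (\<alpha>/2) (\<alpha>/2) (- (t powr (\<alpha>/2)))))"
      unfolding L(2) by (simp only: cauchy_density_def)
  }
  show "completely_monotone (\<lambda>t. t powr (\<alpha>/2 - 1) * mittag_leffler (\<alpha>/2) (\<alpha>/2) (- (t powr (\<alpha>/2))))"
    if "\<alpha> \<le> 2"
    using completely_monotone_ml_kernel[OF a] that by simp
qed

end
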